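(* Let $1<r,p<\infty$. Then there are constants $C_{r,p}>0$ (depending only on $r$ and $p$) and $C_r>0$ (depending only on $r$) such that, for every ergodic measure-preserving transformation $\tau$ of a probability space $(X,\beta,\mu)$, with ergodic maximal function $M^\sharp$, and every sequence $f=(f_1,f_2,f_3,\dots)$ of measurable functions on $X$: (a) $\displaystyle\left\|\left(\sum_{j=1}^\infty|M^\sharp f_j(\cdot)|^r\right)^{1/r}\right\|_p\leq C_{r,p}\left\|\left(\sum_{j=1}^\infty|f_j(\cdot)|^r\right)^{1/r}\right\|_p$; (b) $\displaystyle\mu\left\{x\in X:\left(\sum_{j=1}^\infty|M^\sharp f_j(x)|^r\right)^{1/r}>\lambda\right\}\leq\frac{C_r}{\lambda}\left\|\left(\sum_{j=1}^\infty|f_j(\cdot)|^r\right)^{1/r}\right\|_1$ for all $\lambda>0$.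
   Context: For a measurable function $f$ on $X$, the ergodic maximal function is $$M^\sharp f(x)=\sup_{n\geq1}\frac{1}{n}\sum_{k=0}^{n-1}\left|f(\tau^kx)\right|.$$ The norms $\|\cdot\|_p$ and $\|\cdot\|_1$ are those of $L^p(X,\mu)$ and $L^1(X,\mu)$, with value $+\infty$ allowed. *)

theory Defs
  imports "HOL-Probability.Probability"
begin

definition measure_preserving :: "'a measure \<Rightarrow> ('a \<Rightarrow> 'a) \<Rightarrow> bool" where
  "measure_preserving M \<tau> \<longleftrightarrow>
     \<tau> \<in> measurable M M \<and>
     (\<forall>A\<in>sets M. emeasure M (\<tau> -` A \<inter> space M) = emeasure M A)"

definition ergodic_transformation :: "'a measure \<Rightarrow> ('a \<Rightarrow> 'a) \<Rightarrow> bool" where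
  "ergodic_transformation M \<tau> \<longleftrightarrow>
     measure_preserving M \<tau> \<and>
     (\<forall>A\<in>sets M. \<tau> -` A \<inter> space M = A \<longrightarrow> measure M A = 0 \<or> measure M A = 1)"

text \<open>The maximal function may take the value \<open>\<infinity>\<close>, so it is valued in \<^typ>\<open>ennreal\<close>.\<close>

definition ergodic_maximal :: "('a \<Rightarrow> 'a) \<Rightarrow> ('a \<Rightarrow> complex) \<Rightarrow> 'a \<Rightarrow> ennreal" where
  "ergodic_maximal \<tau> f x =
     (SUP n\<in>{1..}. ennreal ((1 / real n) * (\<Sum>k<n. norm (f ((\<tau> ^^ k) x)))))"

text \<open>Powers with a positive real exponent on \<open>[0,\<infinity>]\<close>; only used for \<open>a > 0\<close>, where
  \<open>0\<close> and \<open>\<infinity>\<close> are fixed.\<close>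

definition ennpowr :: "ennreal \<Rightarrow> real \<Rightarrow> ennreal" where
  "ennpowr x a = (if x = \<infinity> then \<infinity> else ennreal (enn2real x powr a))"

definition lr_norm :: "real \<Rightarrow> (nat \<Rightarrow> ennreal) \<Rightarrow> ennreal" where
  "lr_norm r u = ennpowr (\<Sum>j. ennpowr (u j) r) (1 / r)"

definition Lp_norm :: "'a measure \<Rightarrow> real \<Rightarrow> ('a \<Rightarrow> ennreal) \<Rightarrow> ennreal" where
  "Lp_norm M p g = ennpowr (\<integral>\<^sup>+ x. ennpowr (g x) p \<partial>M) (1 / p)"

text \<open>
  A constant introduced by an existential quantifier in a statement about all measures of
  type \<open>'a measure\<close> could depend on the type \<open>'a\<close>. To obtain constants that are the same for
  probability spaces over every type, they are declared here as functions of the exponents alone: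
  some positive constant for which the inequality holds on all ergodic systems carried by the
  fixed type \<open>nat \<Rightarrow> nat \<Rightarrow> complex\<close>. That type suffices, because
  \<open>x \<mapsto> (\<lambda>k j. f j ((\<tau> ^^ k) x))\<close> maps every system with a sequence of functions \<open>f j\<close> to a
  shift-invariant measure on it. The definitions by themselves assert neither that such constants
  exist nor that they are positive.
\<close>

definition strong_const :: "real \<Rightarrow> real \<Rightarrow> real" where
  "strong_const r p = (SOME C. C > 0 \<and>
     (\<forall>(M :: (nat \<Rightarrow> nat \<Rightarrow> complex) measure) \<tau> f.
        prob_space M \<longrightarrow> ergodic_transformation M \<tau> \<longrightarrow> (\<forall>j. f j \<in> borel_measurable M) \<longrightarrow>
        Lp_norm M p (\<lambda>x. lr_norm r (\<lambda>j. ergodic_maximal \<tau> (f j) x))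
          \<le> ennreal C * Lp_norm M p (\<lambda>x. lr_norm r (\<lambda>j. ennreal (norm (f j x))))))"

definition weak_const :: "real \<Rightarrow> real" where
  "weak_const r = (SOME C. C > 0 \<and>
     (\<forall>(M :: (nat \<Rightarrow> nat \<Rightarrow> complex) measure) \<tau> f.
        prob_space M \<longrightarrow> ergodic_transformation M \<tau> \<longrightarrow> (\<forall>j. f j \<in> borel_measurable M) \<longrightarrow>
        (\<forall>t>0. emeasure M {x \<in> space M.
              lr_norm r (\<lambda>j. ergodic_maximal \<tau> (f j) x) > ennreal t}
          \<le> ennreal (C / t) * Lp_norm M 1 (\<lambda>x. lr_norm r (\<lambda>j. ennreal (norm (f j x)))))))"

end

theory Submission
  imports Defs
begin

text \<open>
  This is the Fefferman--Stein inequality for the ergodic maximal function. Along an orbit the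
  maximal function is the one-sided Hardy--Littlewood maximal function of a sequence of numbers,
  so everything is first proved for finite stretches of sequences, with constants that do not
  depend on the length of the stretch or on the number \<open>J\<close> of components, and then integrated.

  For sequences the whole theory grows out of one construction, \<open>leftward_levelling\<close>.
  Fix a level \<open>t\<close> and treat the vector \<open>f k\<close> as work arriving at the site \<open>k\<close>. Walking from
  right to left, each site keeps as much as has \<open>\<ell>\<^sup>r\<close>-norm at most \<open>t\<close> and passes the excess to
  its left neighbour. The levelled sequence \<open>g\<close> is bounded by \<open>t\<close> and has no larger total norm.
  Mass moves to the left only, so from a site that passes nothing on, all forward sums of \<open>g\<close>
  dominate those of \<open>f\<close>, in every component. A site that passes something on keeps exactly the
  norm \<open>t\<close>, so there are few of those. This replaces the Calderon--Zygmund decomposition.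

  For a single component it gives the scalar weak type inequality at once, and, by truncation and
  integration over the levels, the scalar \<open>L\<^sup>p\<close> inequality (\<open>fmax_strong_type\<close>). For vectors,
  the case \<open>p = r\<close> is the scalar inequality summed over the components. Applied to the levelled
  sequence, the case \<open>p = r\<close> gives the vector weak type \<open>(1,1)\<close> inequality (\<open>vmax_weak_type\<close>).
  All other \<open>p > 1\<close> follow from a good-lambda inequality (\<open>vmax_good_lambda\<close>) that compares the
  vector maximal function \<open>G\<close> of \<open>f\<close> with the scalar maximal function of the norms of \<open>f\<close>. On a
  maximal run of sites where \<open>G > s\<close>, a window that leaves the run on the right contributes at most
  the value of \<open>G\<close> at the end of the run, which is at most \<open>s\<close>; what lies inside the run is
  controlled by the weak type inequality. The argument is the same for
  \<open>p < r\<close> and for \<open>p > r\<close>.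

  In the last step the constants are carried from systems over the type
  \<open>nat \<Rightarrow> nat \<Rightarrow> complex\<close> to systems over an arbitrary type, by passing to the
  distribution of the itineraries \<open>x \<mapsto> (\<lambda>k j. f j ((\<tau> ^^ k) x))\<close> under the shift.
\<close>

section \<open>The \<open>\<ell>\<^sup>r\<close> norm of finitely many components\<close>

definition lr_fin :: "real \<Rightarrow> nat \<Rightarrow> (nat \<Rightarrow> real) \<Rightarrow> real" where
  "lr_fin r J v = (\<Sum>j<J. v j powr r) powr (1 / r)"

lemma lr_fin_nonneg [simp]: "0 \<le> lr_fin r J v"
  by (simp add: lr_fin_def)

lemma lr_fin_powr:
  assumes "0 < r"
  shows "lr_fin r J v powr r = (\<Sum>j<J. v j powr r)"
  using assms by (simp add: lr_fin_def powr_powr sum_nonneg)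

lemma lr_fin_scale:
  assumes "0 < r" "0 \<le> c" "\<And>j. 0 \<le> v j"
  shows "lr_fin r J (\<lambda>j. c * v j) = c * lr_fin r J v"
proof -
  have "(\<Sum>j<J. (c * v j) powr r) = c powr r * (\<Sum>j<J. v j powr r)"
    using assms by (simp add: powr_mult sum_distrib_left)
  then show ?thesis
    using assms by (simp add: lr_fin_def powr_mult powr_powr sum_nonneg)
qed

lemma lr_fin_mono:
  assumes "0 < r" "\<And>j. 0 \<le> u j" "\<And>j. u j \<le> v j"
  shows "lr_fin r J u \<le> lr_fin r J v"
  unfolding lr_fin_def using assms
  by (intro powr_mono2 sum_mono sum_nonneg) auto

lemma lr_fin_zero_iff:
  assumes "0 < r" "\<And>j. 0 \<le> v j"
  shows "lr_fin r J v = 0 \<longleftrightarrow> (\<forall>j<J. v j = 0)"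
proof -
  have "(\<Sum>j<J. v j powr r) = 0 \<longleftrightarrow> (\<forall>j\<in>{..<J}. v j powr r = 0)"
    by (rule sum_nonneg_eq_0_iff) auto
  then show ?thesis
    unfolding lr_fin_def using assms by auto
qed

text \<open>The convexity of \<open>x \<mapsto> x powr r\<close> at the boundary point \<open>0\<close> has to be added to the
  convexity on the open half-line.\<close>
lemma powr_convex_combination:
  fixes x y s r :: real
  assumes "1 \<le> r" "0 \<le> x" "0 \<le> y" "0 \<le> s" "s \<le> 1"
  shows "(s * x + (1 - s) * y) powr r \<le> s * x powr r + (1 - s) * y powr r"
proof -
  have shrink: "(t * z) powr r \<le> t * z powr r" if "0 \<le> t" "t \<le> 1" "0 \<le> z" for t z :: real
  proof -
    have "t powr r \<le> t powr 1" if "0 < t"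
      using that \<open>t \<le> 1\<close> assms by (intro powr_mono') auto
    then have "t powr r \<le> t" using \<open>0 \<le> t\<close> assms by (cases "t = 0") auto
    then show ?thesis using that by (simp add: powr_mult mult_right_mono)
  qed
  consider "x = 0" | "y = 0" | "0 < x" "0 < y" using assms by fastforce
  then show ?thesis
  proof cases
    case 1 then show ?thesis using shrink[of "1 - s" y] assms by simp
  next
    case 2 then show ?thesis using shrink[of s x] assms by simp
  next
    case 3
    then show ?thesis
      using convex_onD[OF powr_convex[OF assms(1)], of "1 - s" x y] assms by simp
  qed
qed

text \<open>Minkowski's inequality. After normalisation, \<open>(u + v) / (A + B)\<close> is in every component the
  convex combination of \<open>u / A\<close> and \<open>v / B\<close> with weights \<open>A / (A + B)\<close> and \<open>B / (A + B)\<close>, and both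
  have norm \<open>1\<close>.\<close>
lemma lr_fin_triangle:
  assumes r: "1 \<le> r" and u: "\<And>j. 0 \<le> u j" and v: "\<And>j. 0 \<le> v j"
  shows "lr_fin r J (\<lambda>j. u j + v j) \<le> lr_fin r J u + lr_fin r J v"
proof -
  define A where "A = lr_fin r J u"
  define B where "B = lr_fin r J v"
  have r0: "0 < r" using r by simp
  have A0: "0 \<le> A" and B0: "0 \<le> B" by (simp_all add: A_def B_def)
  show ?thesis
  proof (cases "A = 0 \<or> B = 0")
    case True
    then show ?thesis
    proof
      assume "A = 0"
      then have "\<And>j. j < J \<Longrightarrow> u j = 0"
        using lr_fin_zero_iff[of r u J] r0 u by (auto simp: A_def)
      then have "lr_fin r J (\<lambda>j. u j + v j) = B" by (simp add: lr_fin_def B_def)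
      then show ?thesis using A0 by (simp add: A_def B_def)
    next
      assume "B = 0"
      then have "\<And>j. j < J \<Longrightarrow> v j = 0"
        using lr_fin_zero_iff[of r v J] r0 v by (auto simp: B_def)
      then have "lr_fin r J (\<lambda>j. u j + v j) = A" by (simp add: lr_fin_def A_def)
      then show ?thesis using B0 by (simp add: A_def B_def)
    qed
  next
    case False
    then have A: "0 < A" and B: "0 < B" using A0 B0 by auto
    define s where "s = A / (A + B)"
    have s: "0 \<le> s" "s \<le> 1" and s1: "1 - s = B / (A + B)"
      using A B by (auto simp: s_def field_simps)
    have normalised: "(\<Sum>j<J. (w j / D) powr r) = 1"
      if "D = lr_fin r J w" "0 < D" "\<And>j. 0 \<le> w j" for w D
    proof -
      have "(\<Sum>j<J. (w j / D) powr r) = (\<Sum>j<J. w j powr r) / D powr r"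
        using that by (simp add: powr_divide sum_divide_distrib)
      also have "\<dots> = 1" using that lr_fin_powr[OF r0, of J w, symmetric] by simp
      finally show ?thesis .
    qed
    have "(\<Sum>j<J. (u j + v j) powr r)
        = (A + B) powr r * (\<Sum>j<J. (s * (u j / A) + (1 - s) * (v j / B)) powr r)"
    proof -
      have "s * (u j / A) = u j / (A + B)" "(1 - s) * (v j / B) = v j / (A + B)" for j
        unfolding s1 using A B by (simp_all add: s_def)
      then have "u j + v j = (A + B) * (s * (u j / A) + (1 - s) * (v j / B))" for j
        using A B by (simp add: add_divide_distrib[symmetric])
      then have "(u j + v j) powr r
          = (A + B) powr r * (s * (u j / A) + (1 - s) * (v j / B)) powr r" for j
        by (metis (no_types, lifting) A B u v s powr_mult diff_ge_0_iff_ge)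
      then show ?thesis by (simp add: sum_distrib_left)
    qed
    also have "\<dots> \<le> (A + B) powr r *
        (\<Sum>j<J. s * (u j / A) powr r + (1 - s) * (v j / B) powr r)"
      using r s u v A B by (intro mult_left_mono sum_mono powr_convex_combination) auto
    also have "(\<Sum>j<J. s * (u j / A) powr r + (1 - s) * (v j / B) powr r) = s * 1 + (1 - s) * 1"
      using normalised[OF A_def A u] normalised[OF B_def B v]
      by (simp only: sum.distrib sum_distrib_left[symmetric])
    finally have "(\<Sum>j<J. (u j + v j) powr r) \<le> (A + B) powr r" by simp
    then have "(\<Sum>j<J. (u j + v j) powr r) powr (1 / r) \<le> ((A + B) powr r) powr (1 / r)"
      using r0 by (intro powr_mono2 sum_nonneg) auto
    then show ?thesis
      using r0 A B by (simp add: lr_fin_def A_def B_def powr_powr)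
  qed
qed

section \<open>One-sided maximal functions of finite sequences\<close>

text \<open>Only windows inside \<open>{n..<b}\<close> compete. The finite horizon \<open>b\<close> keeps all sums and maxima
  finite, and the proof of the good-lambda inequality varies it. The value is meaningful
  for \<open>n < b\<close>.\<close>
definition fmax :: "nat \<Rightarrow> (nat \<Rightarrow> real) \<Rightarrow> nat \<Rightarrow> real" where
  "fmax b a n = (MAX m\<in>{n<..b}. (\<Sum>k\<in>{n..<m}. a k) / real (m - n))"

lemma fmax_ge:
  assumes "n < m" "m \<le> b"
  shows "(\<Sum>k\<in>{n..<m}. a k) \<le> fmax b a n * real (m - n)"
proof -
  have "(\<Sum>k\<in>{n..<m}. a k) / real (m - n) \<le> fmax b a n"
    unfolding fmax_def using assms by (intro Max_ge) auto
  then show ?thesis using assms by (simp add: pos_divide_le_eq)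
qed

lemma fmax_le:
  assumes "n < b" "\<And>m. n < m \<Longrightarrow> m \<le> b \<Longrightarrow> (\<Sum>k\<in>{n..<m}. a k) \<le> t * real (m - n)"
  shows "fmax b a n \<le> t"
  unfolding fmax_def
proof (rule Max.boundedI)
  show "(\<lambda>m. (\<Sum>k\<in>{n..<m}. a k) / real (m - n)) ` {n<..b} \<noteq> {}" using assms(1) by auto
qed (use assms in \<open>auto simp: pos_divide_le_eq\<close>)

lemma fmax_nonneg:
  assumes "n < b" "\<And>k. 0 \<le> a k"
  shows "0 \<le> fmax b a n"
  using fmax_ge[of n "Suc n" b a] assms(1) order_trans[OF assms(2)[of n]] by simp

text \<open>A window that crosses \<open>b\<close> splits into one that ends at \<open>b\<close> and one that starts there, and
  its average lies between theirs. This is where one-sidedness helps: the influence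
  of everything beyond \<open>b\<close> is summed up in the value of the maximal function at \<open>b\<close>.\<close>
lemma fmax_split:
  assumes "n < b" "b < c" "\<And>k. 0 \<le> a k"
  shows "fmax c a n \<le> fmax b a n + fmax c a b"
proof (rule fmax_le)
  fix m assume m: "n < m" "m \<le> c"
  let ?x = "fmax b a n" and ?y = "fmax c a b"
  have x: "0 \<le> ?x" and y: "0 \<le> ?y" using assms by (auto intro: fmax_nonneg)
  show "(\<Sum>k\<in>{n..<m}. a k) \<le> (?x + ?y) * real (m - n)"
  proof (cases "m \<le> b")
    case True
    then have "(\<Sum>k\<in>{n..<m}. a k) \<le> ?x * real (m - n)" using m by (intro fmax_ge)
    also have "\<dots> \<le> (?x + ?y) * real (m - n)" using y by (intro mult_right_mono) auto
    finally show ?thesis .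
  next
    case False
    have "(\<Sum>k\<in>{n..<m}. a k) = (\<Sum>k\<in>{n..<b}. a k) + (\<Sum>k\<in>{b..<m}. a k)"
      using False assms by (intro sum.atLeastLessThan_concat[symmetric]) auto
    also have "\<dots> \<le> ?x * real (b - n) + ?y * real (m - b)"
      using False m assms by (intro add_mono fmax_ge) auto
    also have "\<dots> \<le> ?x * real (m - n) + ?y * real (m - n)"
      using False m assms x y by (intro add_mono mult_left_mono) auto
    finally show ?thesis by (simp add: distrib_right)
  qed
qed (use assms in auto)

section \<open>Levelling a sequence from right to left\<close>

text \<open>Here \<open>B\<close> is the set of sites that pass some excess on. If \<open>q n\<close> denotes what \<open>n\<close> passes to
  \<open>n - 1\<close>, then \<open>g k + q k = f k + q (k + 1)\<close>, so the sum of \<open>g\<close> over \<open>{n..<m}\<close> exceeds that of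
  \<open>f\<close> by \<open>q m - q n\<close>, which is nonnegative as soon as \<open>q n = 0\<close>. The vector present at a site is
  split proportionally, so that the norms of the two parts add up, and by the triangle inequality
  the total norm does not increase.\<close>
lemma leftward_levelling:
  fixes f :: "nat \<Rightarrow> nat \<Rightarrow> real"
  assumes r: "1 \<le> r" and t: "0 < t" and f: "\<And>k j. 0 \<le> f k j"
  obtains g B where
    "\<And>k j. 0 \<le> g k j" "\<And>k. lr_fin r J (g k) \<le> t"
    "(\<Sum>k<b. lr_fin r J (g k)) \<le> (\<Sum>k<b. lr_fin r J (f k))"
    "B \<subseteq> {..<b}" "t * real (card B) \<le> (\<Sum>k<b. lr_fin r J (f k))"
    "\<And>n m j. n \<in> {..<b} - B \<Longrightarrow> n < m \<Longrightarrow> m \<le> b \<Longrightarrow> j < J \<Longrightarrow>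
       (\<Sum>k\<in>{n..<m}. f k j) \<le> (\<Sum>k\<in>{n..<m}. g k j)"
proof -
  let ?N = "lr_fin r J"
  have r0: "0 < r" using r by simp
  define keep where "keep v = (if ?N v \<le> t then 1 else t / ?N v)" for v
  \<comment> \<open>\<open>carry i\<close> is what the site \<open>b - i\<close> passes on; counting sites from the right end makes
    the walk a primitive recursion.\<close>
  define carry where "carry = rec_nat (\<lambda>_. 0 :: real)
     (\<lambda>i c j. (1 - keep (\<lambda>j. f (b - Suc i) j + c j)) * (f (b - Suc i) j + c j))"
  have carry0: "carry 0 = (\<lambda>_. 0)" by (simp add: carry_def)
  have carrySuc: "carry (Suc i) = (\<lambda>j. (1 - keep (\<lambda>j. f (b - Suc i) j + carry i j))
      * (f (b - Suc i) j + carry i j))" for i by (simp add: carry_def)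
  have keep: "0 \<le> keep v" "keep v \<le> 1" for v
    using t by (auto simp: keep_def divide_le_eq)
  have carry_nonneg: "0 \<le> carry i j" for i j
  proof (induction i arbitrary: j)
    case (Suc i)
    then show ?case using keep(2) f by (auto simp: carrySuc intro!: mult_nonneg_nonneg add_nonneg_nonneg)
  qed (simp add: carry0)
  define q where "q k = carry (b - k)" for k
  \<comment> \<open>\<open>w k\<close> is present at the site \<open>k\<close>, \<open>g k\<close> stays, \<open>q k\<close> goes to the left.\<close>
  define w where "w k j = f k j + q (Suc k) j" for k j
  define g where "g k j = keep (w k) * w k j" for k j
  have q_nonneg: "0 \<le> q k j" for k j by (simp add: q_def carry_nonneg)
  have w_nonneg: "0 \<le> w k j" for k j by (simp add: w_def f q_nonneg)
  have q_b: "q b = (\<lambda>_. 0)" by (simp add: q_def carry0)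
  have q_step: "q k j = (1 - keep (w k)) * w k j" if "k < b" for k j
  proof -
    from that obtain i where i: "b - k = Suc i" "b - Suc k = i" "b - Suc i = k"
      by (metis Suc_diff_Suc diff_diff_cancel less_imp_le)
    show ?thesis by (simp add: q_def i carrySuc w_def[abs_def])
  qed
  have N_g: "?N (g k) = keep (w k) * ?N (w k)" for k
    unfolding g_def by (rule lr_fin_scale) (auto simp: r0 keep w_nonneg)
  have N_q: "?N (q k) = (1 - keep (w k)) * ?N (w k)" if "k < b" for k
  proof -
    have "q k = (\<lambda>j. (1 - keep (w k)) * w k j)" using q_step[OF that] by auto
    then show ?thesis using lr_fin_scale[of r "1 - keep (w k)" "w k" J] keep w_nonneg r0 by simp
  qed
  have budget: "?N (g k) + ?N (q k) \<le> ?N (f k) + ?N (q (Suc k))" if "k < b" for k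
  proof -
    have "?N (g k) + ?N (q k) = ?N (w k)" by (simp add: N_g N_q that algebra_simps)
    also have "\<dots> \<le> ?N (f k) + ?N (q (Suc k))"
      unfolding w_def using r f q_nonneg by (rule lr_fin_triangle)
    finally show ?thesis .
  qed
  have total: "(\<Sum>k<b. ?N (g k)) \<le> (\<Sum>k<b. ?N (f k))"
  proof -
    have "(\<Sum>k<b. ?N (g k)) \<le> (\<Sum>k<b. ?N (f k) + (?N (q (Suc k)) - ?N (q k)))"
      using budget by (intro sum_mono) (auto simp: algebra_simps)
    also have "\<dots> = (\<Sum>k<b. ?N (f k)) + (?N (q b) - ?N (q 0))"
      using sum_lessThan_telescope[of "\<lambda>k. ?N (q k)" b] by (simp only: sum.distrib)
    also have "?N (q b) = 0" using r0 by (simp add: q_b lr_fin_zero_iff)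
    finally show ?thesis using lr_fin_nonneg[of r J "q 0"] by linarith
  qed
  define B where "B = {k\<in>{..<b}. keep (w k) \<noteq> 1}"
  show thesis
  proof
    show "0 \<le> g k j" for k j by (simp add: g_def keep w_nonneg)
    show "?N (g k) \<le> t" for k using t by (auto simp: N_g keep_def)
    show "(\<Sum>k<b. ?N (g k)) \<le> (\<Sum>k<b. ?N (f k))" by (rule total)
    show "B \<subseteq> {..<b}" by (auto simp: B_def)
    have "t * real (card B) = (\<Sum>k\<in>B. ?N (g k))"
    proof -
      have "?N (g k) = t" if "k \<in> B" for k
        using that t by (auto simp: B_def N_g keep_def split: if_splits)
      then show ?thesis by simp
    qed
    also have "\<dots> \<le> (\<Sum>k<b. ?N (g k))"
      by (intro sum_mono2) (auto simp: B_def)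
    also note total
    finally show "t * real (card B) \<le> (\<Sum>k<b. ?N (f k))" .
    show "(\<Sum>k\<in>{n..<m}. f k j) \<le> (\<Sum>k\<in>{n..<m}. g k j)"
      if n: "n \<in> {..<b} - B" and m: "n < m" "m \<le> b" and "j < J" for n m j
    proof -
      have "g k j = f k j + (q (Suc k) j - q k j)" if "k < b" for k
        by (simp add: q_step[OF that] g_def w_def algebra_simps)
      then have "(\<Sum>k\<in>{n..<m}. g k j) = (\<Sum>k\<in>{n..<m}. f k j + (q (Suc k) j - q k j))"
        using m by (intro sum.cong) auto
      also have "\<dots> = (\<Sum>k\<in>{n..<m}. f k j) + (q m j - q n j)"
        using m sum_Suc_diff'[of n m "\<lambda>k. q k j"] by (simp only: sum.distrib less_imp_le)
      also have "q n j = 0" using n q_step[of n] by (auto simp: B_def)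
      finally show ?thesis using q_nonneg[of m j] by simp
    qed
  qed
qed

section \<open>Scalar maximal inequalities\<close>

text \<open>For scalars the levelled sequence is bounded by \<open>t\<close>, and so are its averages. Hence
  \<open>fmax b a n > t\<close> can only happen at a site that passes mass on.\<close>
lemma fmax_weak_type:
  assumes t: "0 < t" and a: "\<And>k. 0 \<le> a k"
  shows "t * real (card {n\<in>{..<b}. t < fmax b a n}) \<le> (\<Sum>k<b. a k)"
proof -
  have one: "lr_fin 1 1 v = v 0" if "0 \<le> v 0" for v using that by (simp add: lr_fin_def)
  obtain g B where g: "\<And>k j. 0 \<le> g k j" "\<And>k. lr_fin 1 1 (g k) \<le> t"
    and B: "B \<subseteq> {..<b}" "t * real (card B) \<le> (\<Sum>k<b. lr_fin 1 1 (\<lambda>_. a k))"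
    and dom: "\<And>n m j. n \<in> {..<b} - B \<Longrightarrow> n < m \<Longrightarrow> m \<le> b \<Longrightarrow> j < 1 \<Longrightarrow>
       (\<Sum>k\<in>{n..<m}. a k) \<le> (\<Sum>k\<in>{n..<m}. g k j)"
    by (rule leftward_levelling[of 1 t "\<lambda>k _. a k" 1 b]) (use t a in auto)
  have "{n\<in>{..<b}. t < fmax b a n} \<subseteq> B"
  proof (rule ccontr)
    assume "\<not> ?thesis"
    then obtain n where n: "n < b" "n \<notin> B" "t < fmax b a n" by auto
    have "fmax b a n \<le> t"
    proof (rule fmax_le[OF n(1)])
      fix m assume m: "n < m" "m \<le> b"
      have "(\<Sum>k\<in>{n..<m}. a k) \<le> (\<Sum>k\<in>{n..<m}. g k 0)" using dom[of n m 0] n m by auto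
      also have "\<dots> \<le> (\<Sum>k\<in>{n..<m}. t)" using g one by (intro sum_mono) metis
      finally show "(\<Sum>k\<in>{n..<m}. a k) \<le> t * real (m - n)" by (simp add: mult.commute)
    qed
    then show False using n by simp
  qed
  then have "card {n\<in>{..<b}. t < fmax b a n} \<le> card B"
    using B(1) by (intro card_mono) (auto intro: finite_subset)
  then have "t * real (card {n\<in>{..<b}. t < fmax b a n}) \<le> t * real (card B)" using t by simp
  also note B(2)
  finally show ?thesis using a one by simp
qed

text \<open>Values of at most \<open>t / 2\<close> raise the averages by at most \<open>t / 2\<close>, so only the larger values count
  in the bound. This is the form that can be integrated over \<open>t\<close>.\<close>
lemma fmax_weak_type_truncated:
  assumes t: "0 < t" and a: "\<And>k. 0 \<le> a k"
  shows "t * real (card {n\<in>{..<b}. t < fmax b a n}) \<le> 2 * (\<Sum>k<b. a k * of_bool (t < 2 * a k))"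
proof -
  define c where "c k = a k * of_bool (t < 2 * a k)" for k
  have c: "0 \<le> c k" "a k \<le> c k + t / 2" for k using a[of k] t by (auto simp: c_def)
  have "{n\<in>{..<b}. t < fmax b a n} \<subseteq> {n\<in>{..<b}. t / 2 < fmax b c n}"
  proof safe
    fix n assume n: "n < b" "t < fmax b a n"
    have "fmax b a n \<le> fmax b c n + t / 2"
    proof (rule fmax_le[OF n(1)])
      fix m assume m: "n < m" "m \<le> b"
      have "(\<Sum>k\<in>{n..<m}. a k) \<le> (\<Sum>k\<in>{n..<m}. c k + t / 2)" using c by (intro sum_mono) auto
      also have "\<dots> = (\<Sum>k\<in>{n..<m}. c k) + t / 2 * real (m - n)" by (simp add: sum.distrib)
      also have "\<dots> \<le> fmax b c n * real (m - n) + t / 2 * real (m - n)"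
        using fmax_ge[OF m] by simp
      finally show "(\<Sum>k\<in>{n..<m}. a k) \<le> (fmax b c n + t / 2) * real (m - n)"
        by (simp add: distrib_right)
    qed
    then show "t / 2 < fmax b c n" using n by simp
  qed
  then have "card {n\<in>{..<b}. t < fmax b a n} \<le> card {n\<in>{..<b}. t / 2 < fmax b c n}"
    by (intro card_mono) auto
  then have "t / 2 * real (card {n\<in>{..<b}. t < fmax b a n})
      \<le> t / 2 * real (card {n\<in>{..<b}. t / 2 < fmax b c n})" using t by simp
  also have "\<dots> \<le> (\<Sum>k<b. c k)" using t c by (intro fmax_weak_type) auto
  finally show ?thesis by (simp add: c_def)
qed

lemma nn_integral_powr_layer:
  assumes p: "0 < p" and h: "0 \<le> h"
  shows "(\<integral>\<^sup>+s. ennreal (p * s powr (p - 1)) * indicator {0<..<h} s \<partial>lborel) = ennreal (h powr p)"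
proof -
  have "((\<lambda>s. p * s powr (p - 1)) has_integral p * (h powr (p - 1 + 1) / (p - 1 + 1))) {0..h}"
    using p h by (intro has_integral_mult_right has_integral_powr_from_0) auto
  then have i: "((\<lambda>s. p * s powr (p - 1)) has_integral h powr p) {0..h}" using p by simp
  have "(\<integral>\<^sup>+s. ennreal (p * s powr (p - 1)) * indicator {0<..<h} s \<partial>lborel)
      = (\<integral>\<^sup>+s. ennreal (p * s powr (p - 1)) * indicator {0..h} s \<partial>lborel)"
  proof (rule nn_integral_cong_AE)
    have "AE s in lborel. s \<noteq> 0 \<and> s \<noteq> h"
      using AE_lborel_singleton[of 0] AE_lborel_singleton[of h] by eventually_elim auto
    then show "AE s in lborel. ennreal (p * s powr (p - 1)) * indicator {0<..<h} s
        = ennreal (p * s powr (p - 1)) * indicator {0..h} s"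
      by eventually_elim (auto simp: indicator_def)
  qed
  also have "\<dots> = ennreal (h powr p)"
    using p by (intro nn_integral_has_integral_lebesgue'[OF _ i]) auto
  finally show ?thesis .
qed

text \<open>\<open>u n powr p\<close> is the integral of \<open>p * s powr (p - 1)\<close> over \<open>{0<..<u n}\<close>.\<close>
lemma layer_cake:
  assumes p: "0 < p" and S: "finite S" and u: "\<And>n. n \<in> S \<Longrightarrow> 0 \<le> u n"
  shows "(\<integral>\<^sup>+s. ennreal (p * s powr (p - 1)) * (indicator {0<..} s * ennreal (real (card {n\<in>S. s < u n}))) \<partial>lborel)
    = ennreal (\<Sum>n\<in>S. u n powr p)"
proof -
  have "indicator {0<..} s * ennreal (real (card {n\<in>S. s < u n}))
      = (\<Sum>n\<in>S. indicator {0<..<u n} s)" for s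
  proof (cases "0 < s")
    case True
    have "(\<Sum>n\<in>S. indicator {0<..<u n} s :: ennreal) = (\<Sum>n\<in>S. ennreal (of_bool (s < u n)))"
      using True by (intro sum.cong) auto
    also have "\<dots> = ennreal (\<Sum>n\<in>S. of_bool (s < u n))" by (intro sum_ennreal) auto
    also have "(\<Sum>n\<in>S. of_bool (s < u n) :: real) = real (card {n\<in>S. s < u n})"
      using S by (simp add: Int_def sum.If_cases of_bool_def)
    finally show ?thesis using True by simp
  qed simp
  then have "(\<integral>\<^sup>+s. ennreal (p * s powr (p - 1)) * (indicator {0<..} s * ennreal (real (card {n\<in>S. s < u n}))) \<partial>lborel)
      = (\<integral>\<^sup>+s. (\<Sum>n\<in>S. ennreal (p * s powr (p - 1)) * indicator {0<..<u n} s) \<partial>lborel)"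
    by (simp add: sum_distrib_left)
  also have "\<dots> = (\<Sum>n\<in>S. \<integral>\<^sup>+s. ennreal (p * s powr (p - 1)) * indicator {0<..<u n} s \<partial>lborel)"
    by (rule nn_integral_sum) auto
  also have "\<dots> = (\<Sum>n\<in>S. ennreal (u n powr p))"
    using p u by (intro sum.cong nn_integral_powr_layer) auto
  finally show ?thesis by simp
qed

text \<open>Integrating a comparison of distribution functions. The term with the small factor
  \<open>\<epsilon>\<close> is there to be absorbed in good-lambda arguments.\<close>
lemma sum_powr_le_of_level_sets:
  fixes u v w :: "'b \<Rightarrow> real"
  assumes p: "0 < p" and S: "finite S"
    and nonneg: "\<And>n. n \<in> S \<Longrightarrow> 0 \<le> u n" "\<And>n. n \<in> S \<Longrightarrow> 0 \<le> v n" "\<And>n. n \<in> S \<Longrightarrow> 0 \<le> w n"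
    and \<epsilon>: "0 \<le> \<epsilon>"
    and level: "\<And>s. 0 < s \<Longrightarrow>
      real (card {n\<in>S. s < u n}) \<le> \<epsilon> * real (card {n\<in>S. s < v n}) + real (card {n\<in>S. s < w n})"
  shows "(\<Sum>n\<in>S. u n powr p) \<le> \<epsilon> * (\<Sum>n\<in>S. v n powr p) + (\<Sum>n\<in>S. w n powr p)"
proof -
  define \<rho> where "\<rho> s = ennreal (p * s powr (p - 1))" for s
  define c where "c z s = indicator {0<..} s * ennreal (real (card {n\<in>S. s < z n}))"
    for z :: "'b \<Rightarrow> real" and s :: real
  have cake: "(\<integral>\<^sup>+s. \<rho> s * c z s \<partial>lborel) = ennreal (\<Sum>n\<in>S. z n powr p)"
    if "\<And>n. n \<in> S \<Longrightarrow> 0 \<le> z n" for z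
    unfolding \<rho>_def c_def using p S that by (rule layer_cake)
  have meas: "(\<lambda>s. \<rho> s * c z s) \<in> borel_measurable lborel" for z
  proof -
    have "real (card {n\<in>S. s < z n}) = (\<Sum>n\<in>S. indicator {..<z n} s)" for s
      using S by (simp add: Int_def sum.If_cases indicator_def)
    then show ?thesis unfolding \<rho>_def c_def by simp
  qed
  have "ennreal (\<Sum>n\<in>S. u n powr p) = (\<integral>\<^sup>+s. \<rho> s * c u s \<partial>lborel)"
    using cake nonneg by simp
  also have "\<dots> \<le> (\<integral>\<^sup>+s. ennreal \<epsilon> * (\<rho> s * c v s) + \<rho> s * c w s \<partial>lborel)"
  proof (intro nn_integral_mono)
    fix s :: real
    have "c u s \<le> ennreal \<epsilon> * c v s + c w s"
      using level[of s] \<epsilon> unfolding c_def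
      by (cases "0 < s") (simp_all add: ennreal_mult[symmetric] ennreal_plus[symmetric] del: ennreal_plus)
    then have "\<rho> s * c u s \<le> \<rho> s * (ennreal \<epsilon> * c v s + c w s)" by (intro mult_left_mono) auto
    then show "\<rho> s * c u s \<le> ennreal \<epsilon> * (\<rho> s * c v s) + \<rho> s * c w s"
      by (simp add: distrib_left mult_ac)
  qed
  also have "\<dots> = ennreal \<epsilon> * (\<integral>\<^sup>+s. \<rho> s * c v s \<partial>lborel) + (\<integral>\<^sup>+s. \<rho> s * c w s \<partial>lborel)"
    using meas by (subst nn_integral_add) (auto intro!: nn_integral_cmult borel_measurable_times)
  also have "\<dots> = ennreal (\<epsilon> * (\<Sum>n\<in>S. v n powr p) + (\<Sum>n\<in>S. w n powr p))"
    using cake nonneg \<epsilon> by (simp add: ennreal_mult[symmetric] ennreal_plus[symmetric] sum_nonneg del: ennreal_plus)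
  finally show ?thesis
    using \<epsilon> by (subst (asm) ennreal_le_iff) (auto intro!: add_nonneg_nonneg mult_nonneg_nonneg sum_nonneg)
qed

definition hl_const :: "real \<Rightarrow> real" where
  "hl_const p = p / (p - 1) * 2 powr p"

lemma hl_const_pos: "1 < p \<Longrightarrow> 0 < hl_const p"
  by (simp add: hl_const_def)

lemma fmax_strong_type:
  assumes p: "1 < p" and a: "\<And>k. 0 \<le> a k"
  shows "(\<Sum>n<b. fmax b a n powr p) \<le> hl_const p * (\<Sum>k<b. a k powr p)"
proof -
  have "ennreal (\<Sum>n<b. fmax b a n powr p)
      = (\<integral>\<^sup>+s. ennreal (p * s powr (p - 1)) * (indicator {0<..} s *
          ennreal (real (card {n\<in>{..<b}. s < fmax b a n}))) \<partial>lborel)"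
    using p a by (intro layer_cake[symmetric]) (auto intro: fmax_nonneg)
  also have "\<dots> \<le> (\<integral>\<^sup>+s. (\<Sum>k<b. ennreal (2 * p / (p - 1) * a k) *
        (ennreal ((p - 1) * s powr (p - 1 - 1)) * indicator {0<..<2 * a k} s)) \<partial>lborel)"
  proof (intro nn_integral_mono)
    fix s :: real
    show "ennreal (p * s powr (p - 1)) * (indicator {0<..} s *
          ennreal (real (card {n\<in>{..<b}. s < fmax b a n})))
      \<le> (\<Sum>k<b. ennreal (2 * p / (p - 1) * a k) *
          (ennreal ((p - 1) * s powr (p - 1 - 1)) * indicator {0<..<2 * a k} s))"
    proof (cases "0 < s")
      case True
      have eq: "s powr (p - 1) = s * s powr (p - 1 - 1)"
        using True by (simp add: powr_mult_base)
      have "p * s powr (p - 1) * real (card {n\<in>{..<b}. s < fmax b a n})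
          = p * s powr (p - 1 - 1) * (s * real (card {n\<in>{..<b}. s < fmax b a n}))"
        by (simp add: eq mult_ac)
      also have "\<dots> \<le> p * s powr (p - 1 - 1) * (2 * (\<Sum>k<b. a k * of_bool (s < 2 * a k)))"
        using p True a by (intro mult_left_mono fmax_weak_type_truncated) auto
      also have "\<dots> = (\<Sum>k<b. 2 * p / (p - 1) * a k * ((p - 1) * s powr (p - 1 - 1) * of_bool (s < 2 * a k)))"
        unfolding sum_distrib_left using p by (intro sum.cong) auto
      finally have le: "p * s powr (p - 1) * real (card {n\<in>{..<b}. s < fmax b a n}) \<le> \<dots>" .
      have "ennreal (p * s powr (p - 1)) * (indicator {0<..} s *
          ennreal (real (card {n\<in>{..<b}. s < fmax b a n})))
          = ennreal (p * s powr (p - 1) * real (card {n\<in>{..<b}. s < fmax b a n}))"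
        using True p by (simp add: ennreal_mult)
      also have "\<dots> \<le> ennreal (\<Sum>k<b. 2 * p / (p - 1) * a k * ((p - 1) * s powr (p - 1 - 1) * of_bool (s < 2 * a k)))"
        using le by (rule ennreal_leI)
      also have "\<dots> = (\<Sum>k<b. ennreal (2 * p / (p - 1) * a k * ((p - 1) * s powr (p - 1 - 1) * of_bool (s < 2 * a k))))"
        using p a by (intro sum_ennreal[symmetric]) auto
      also have "\<dots> = (\<Sum>k<b. ennreal (2 * p / (p - 1) * a k) *
          (ennreal ((p - 1) * s powr (p - 1 - 1)) * indicator {0<..<2 * a k} s))"
        using p a True by (intro sum.cong) (auto simp: ennreal_mult[symmetric] indicator_def)
      finally show ?thesis .
    qed simp
  qed
  also have "\<dots> = (\<Sum>k<b. ennreal (2 * p / (p - 1) * a k) *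
      (\<integral>\<^sup>+s. ennreal ((p - 1) * s powr (p - 1 - 1)) * indicator {0<..<2 * a k} s \<partial>lborel))"
    by (subst nn_integral_sum) (auto intro!: sum.cong nn_integral_cmult)
  also have "\<dots> = (\<Sum>k<b. ennreal (2 * p / (p - 1) * a k) * ennreal ((2 * a k) powr (p - 1)))"
    using p a by (intro sum.cong refl arg_cong2[where f = "(*)"] nn_integral_powr_layer) auto
  also have "\<dots> = (\<Sum>k<b. ennreal (hl_const p * a k powr p))"
  proof (intro sum.cong refl)
    fix k
    have "2 * a k * (2 * a k) powr (p - 1) = (2 * a k) powr p"
      using a[of k] by (cases "a k = 0") (auto simp: powr_mult_base)
    then have "2 * p / (p - 1) * a k * (2 * a k) powr (p - 1) = hl_const p * a k powr p"
      using a[of k] by (simp add: hl_const_def powr_mult mult_ac)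
    then show "ennreal (2 * p / (p - 1) * a k) * ennreal ((2 * a k) powr (p - 1))
        = ennreal (hl_const p * a k powr p)"
      using p a[of k] by (simp add: ennreal_mult[symmetric])
  qed
  also have "\<dots> = ennreal (hl_const p * (\<Sum>k<b. a k powr p))"
    using p by (simp add: sum_distrib_left hl_const_def)
  finally show ?thesis
    using p by (subst (asm) ennreal_le_iff)
      (auto simp: hl_const_def intro!: mult_nonneg_nonneg divide_nonneg_nonneg sum_nonneg)
qed

section \<open>Vector-valued maximal inequalities for finite sequences\<close>

definition vmax :: "real \<Rightarrow> nat \<Rightarrow> nat \<Rightarrow> (nat \<Rightarrow> nat \<Rightarrow> real) \<Rightarrow> nat \<Rightarrow> real" where
  "vmax r J b f n = lr_fin r J (\<lambda>j. fmax b (\<lambda>k. f k j) n)"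

lemma vmax_nonneg: "0 \<le> vmax r J b f n"
  by (simp add: vmax_def)

lemma vmax_strong_type_diagonal:
  assumes r: "1 < r" and f: "\<And>k j. 0 \<le> f k j"
  shows "(\<Sum>n<b. vmax r J b f n powr r) \<le> hl_const r * (\<Sum>k<b. lr_fin r J (f k) powr r)"
proof -
  have "(\<Sum>n<b. vmax r J b f n powr r) = (\<Sum>j<J. \<Sum>n<b. fmax b (\<lambda>k. f k j) n powr r)"
    using r by (simp add: vmax_def lr_fin_powr) (rule sum.swap)
  also have "\<dots> \<le> (\<Sum>j<J. hl_const r * (\<Sum>k<b. f k j powr r))"
    using r f by (intro sum_mono fmax_strong_type) auto
  also have "\<dots> = hl_const r * (\<Sum>j<J. \<Sum>k<b. f k j powr r)" by (simp add: sum_distrib_left)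
  also have "\<dots> = hl_const r * (\<Sum>k<b. lr_fin r J (f k) powr r)"
    using r by (simp add: lr_fin_powr) (rule disjI2, rule sum.swap)
  finally show ?thesis .
qed

text \<open>Level \<open>f\<close> at height \<open>t\<close>. Outside the few sites that pass mass on, the maximal function of the
  levelled \<open>g\<close> is the larger one, and it obeys Chebyshev's inequality with exponent \<open>r\<close>. Since the norm
  of \<open>g k\<close> is at most \<open>t\<close>, its \<open>r\<close>-th power is at most \<open>t powr (r - 1)\<close> times the norm itself,
  which turns the \<open>L\<^sup>r\<close> bound into an \<open>L\<^sup>1\<close> bound.\<close>
lemma vmax_weak_type:
  assumes r: "1 < r" and f: "\<And>k j. 0 \<le> f k j" and t: "0 < t"
  shows "t * real (card {n\<in>{..<b}. t < vmax r J b f n})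
    \<le> (1 + hl_const r) * (\<Sum>k<b. lr_fin r J (f k))"
proof -
  let ?N = "lr_fin r J"
  have C: "0 \<le> hl_const r" using hl_const_pos[OF r] by simp
  obtain g B where g: "\<And>k j. 0 \<le> g k j" "\<And>k. ?N (g k) \<le> t"
      "(\<Sum>k<b. ?N (g k)) \<le> (\<Sum>k<b. ?N (f k))"
    and B: "B \<subseteq> {..<b}" "t * real (card B) \<le> (\<Sum>k<b. ?N (f k))"
    and dom: "\<And>n m j. n \<in> {..<b} - B \<Longrightarrow> n < m \<Longrightarrow> m \<le> b \<Longrightarrow> j < J \<Longrightarrow>
       (\<Sum>k\<in>{n..<m}. f k j) \<le> (\<Sum>k\<in>{n..<m}. g k j)"
    by (rule leftward_levelling[of r t f J b]) (use r t f in auto)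
  define E where "E = {n\<in>{..<b}. t < vmax r J b g n}"
  have "{n\<in>{..<b}. t < vmax r J b f n} \<subseteq> B \<union> E"
  proof
    fix n assume n: "n \<in> {n\<in>{..<b}. t < vmax r J b f n}"
    show "n \<in> B \<union> E"
    proof (cases "n \<in> B")
      case False
      have "fmax b (\<lambda>k. f k j) n \<le> fmax b (\<lambda>k. g k j) n" if "j < J" for j
        using n False that by (intro fmax_le order_trans[OF dom fmax_ge]) auto
      then have "vmax r J b f n \<le> vmax r J b g n"
        unfolding vmax_def lr_fin_def using r f n
        by (intro powr_mono2 sum_mono sum_nonneg) (auto intro: fmax_nonneg)
      then show ?thesis using n by (simp add: E_def)
    qed simp
  qed
  then have "card {n\<in>{..<b}. t < vmax r J b f n} \<le> card (B \<union> E)"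
    using B by (intro card_mono) (auto simp: E_def intro: finite_subset)
  also have "\<dots> \<le> card B + card E" by (rule card_Un_le)
  finally have "t * real (card {n\<in>{..<b}. t < vmax r J b f n}) \<le> t * (real (card B) + real (card E))"
    using t by (intro mult_left_mono) auto
  moreover have "t * real (card E) \<le> hl_const r * (\<Sum>k<b. ?N (f k))"
  proof -
    have "t powr r * real (card E) = (\<Sum>n\<in>E. t powr r)" by simp
    also have "\<dots> \<le> (\<Sum>n\<in>E. vmax r J b g n powr r)"
      using t r by (intro sum_mono powr_mono2) (auto simp: E_def)
    also have "\<dots> \<le> (\<Sum>n<b. vmax r J b g n powr r)"
      by (intro sum_mono2) (auto simp: E_def)
    also have "\<dots> \<le> hl_const r * (\<Sum>k<b. ?N (g k) powr r)"
      using r g by (intro vmax_strong_type_diagonal) auto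
    also have "\<dots> \<le> hl_const r * (\<Sum>k<b. t powr (r - 1) * ?N (g k))"
    proof (intro mult_left_mono[OF _ C] sum_mono)
      fix k
      have "?N (g k) powr r = ?N (g k) powr (r - 1) * ?N (g k)"
        by (cases "?N (g k) = 0") (auto simp: powr_mult_base mult.commute)
      also have "\<dots> \<le> t powr (r - 1) * ?N (g k)"
        using r g by (intro mult_right_mono powr_mono2) auto
      finally show "?N (g k) powr r \<le> t powr (r - 1) * ?N (g k)" .
    qed
    also have "\<dots> = t powr (r - 1) * (hl_const r * (\<Sum>k<b. ?N (g k)))"
      by (simp add: sum_distrib_left mult_ac)
    also have "t powr r = t powr (r - 1) * t"
      using t by (simp add: powr_mult_base mult.commute)
    finally have "t * real (card E) \<le> hl_const r * (\<Sum>k<b. ?N (g k))"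
      using t by (simp add: mult.assoc)
    also have "\<dots> \<le> hl_const r * (\<Sum>k<b. ?N (f k))"
      using g C by (intro mult_left_mono) auto
    finally show ?thesis .
  qed
  ultimately show ?thesis using B by (simp add: algebra_simps)
qed

lemma fmax_cong:
  assumes "\<And>k. n \<le> k \<Longrightarrow> k < b \<Longrightarrow> a k = a' k"
  shows "fmax b a n = fmax b a' n"
  unfolding fmax_def using assms
  by (intro arg_cong[where f = Max] image_cong refl arg_cong2[where f = "(/)"] sum.cong) auto

text \<open>The maximal function at \<open>n\<close> ignores everything to the left of \<open>n\<close>, so on \<open>{a..<b}\<close> the
  sequence may be replaced by \<open>0\<close> before \<open>a\<close>.\<close>
lemma vmax_weak_type_from:
  assumes r: "1 < r" and f: "\<And>k j. 0 \<le> f k j" and t: "0 < t"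
  shows "t * real (card {n\<in>{a..<b}. t < vmax r J b f n})
    \<le> (1 + hl_const r) * (\<Sum>k\<in>{a..<b}. lr_fin r J (f k))"
proof -
  define f' where "f' k j = (if a \<le> k then f k j else 0)" for k j
  have "vmax r J b f n = vmax r J b f' n" if "a \<le> n" for n
    unfolding vmax_def f'_def using that by (intro arg_cong[where f = "lr_fin r J"] ext fmax_cong) auto
  then have "card {n\<in>{a..<b}. t < vmax r J b f n} \<le> card {n\<in>{..<b}. t < vmax r J b f' n}"
    by (intro card_mono) auto
  then have "t * real (card {n\<in>{a..<b}. t < vmax r J b f n})
      \<le> t * real (card {n\<in>{..<b}. t < vmax r J b f' n})" using t by simp
  also have "\<dots> \<le> (1 + hl_const r) * (\<Sum>k<b. lr_fin r J (f' k))"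
    using r f t by (intro vmax_weak_type) (auto simp: f'_def)
  also have "(\<Sum>k<b. lr_fin r J (f' k)) = (\<Sum>k\<in>{a..<b}. lr_fin r J (f' k))"
    using r by (intro sum.mono_neutral_right) (auto simp: f'_def[abs_def] lr_fin_zero_iff)
  also have "\<dots> = (\<Sum>k\<in>{a..<b}. lr_fin r J (f k))"
    by (intro sum.cong) (auto simp: f'_def[abs_def])
  finally show ?thesis .
qed

text \<open>Let \<open>E\<close> be the set where the vector maximal function exceeds \<open>s\<close>, and let \<open>{a..<b}\<close> be
  the part of a run of \<open>E\<close> from the first site \<open>a\<close> of the set on the left-hand side onwards.
  Beyond the horizon \<open>b\<close> only \<open>s\<close> is gained, because the maximal function at \<open>b\<close> is at most \<open>s\<close>.
  A value above \<open>2 * s\<close> therefore forces the maximal function with horizon \<open>b\<close>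
  above \<open>s\<close>. The weak type inequality on \<open>{a..<b}\<close> applies, and the average of the norms over
  \<open>{a..<b}\<close> is at most \<open>\<gamma> * s\<close> by the choice of \<open>a\<close>.\<close>
lemma vmax_good_lambda:
  assumes r: "1 < r" and f: "\<And>k j. 0 \<le> f k j" and s: "0 < s" and \<gamma>: "0 < \<gamma>"
  shows "real (card {n\<in>{..<N}. 2 * s < vmax r J N f n \<and> fmax N (\<lambda>k. lr_fin r J (f k)) n \<le> \<gamma> * s})
    \<le> (1 + hl_const r) * \<gamma> * real (card {n\<in>{..<N}. s < vmax r J N f n})"
proof -
  let ?F = "\<lambda>k. lr_fin r J (f k)"
  define K where "K = 1 + hl_const r"
  have K: "0 \<le> K" using hl_const_pos[OF r] by (simp add: K_def)
  define E where "E = {n\<in>{..<N}. s < vmax r J N f n}"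
  define A where "A = {n\<in>{..<N}. 2 * s < vmax r J N f n \<and> fmax N ?F n \<le> \<gamma> * s}"
  have fin: "finite A" "finite E" by (auto simp: A_def E_def)
  have AE: "A \<subseteq> E" using s by (auto simp: A_def E_def)
  \<comment> \<open>\<open>d n\<close> is the right end of the run of \<open>E\<close> that contains \<open>n\<close>; its fibres are the runs.\<close>
  define d where "d n = (LEAST m. n \<le> m \<and> m \<notin> E)" for n
  have d: "n \<le> d n" "d n \<notin> E" if "n \<le> N" for n
    using LeastI[of "\<lambda>m. n \<le> m \<and> m \<notin> E" N] that by (auto simp: d_def E_def)
  have d_le: "d n \<le> m" if "n \<le> m" "m \<notin> E" for n m
    using that by (auto simp: d_def intro: Least_le)
  have run: "k \<in> E \<and> d k = d n" if "n \<le> k" "k < d n" for n k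
  proof -
    have kE: "k \<in> E" using d_le[of n k] that by force
    then have "k \<le> N" by (simp add: E_def)
    moreover from this have "n \<le> N" using that by simp
    ultimately have "d k = d n"
      using d[of k] d[of n] that d_le[of k "d n"] d_le[of n "d k"] by force
    then show ?thesis using kE by simp
  qed
  have piece: "real (card {n\<in>A. d n = b}) \<le> K * \<gamma> * real (card {n\<in>E. d n = b})" for b
  proof (cases "{n\<in>A. d n = b} = {}")
    case True
    show ?thesis unfolding True using K \<gamma> by simp
  next
    case False
    define a where "a = Min {n\<in>A. d n = b}"
    have aA: "a \<in> A" and ab: "d a = b"
      using Min_in[OF _ False] fin by (auto simp: a_def)
    have "a < N" and Fa: "fmax N ?F a \<le> \<gamma> * s" using aA by (auto simp: A_def)
    have "a < b"
      using d[of a] \<open>a < N\<close> ab aA AE by (metis le_neq_implies_less less_imp_le subsetD)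
    have "b \<notin> E" using d(2)[of a] \<open>a < N\<close> ab by auto
    have "b \<le> N" using d_le[of a N] \<open>a < N\<close> ab by (auto simp: E_def)
    have "{n\<in>A. d n = b} \<subseteq> {n\<in>{a..<b}. s < vmax r J b f n}"
    proof safe
      fix n assume n: "n \<in> A" "b = d n"
      show "n \<in> {a..<d n}"
      proof -
        have "a \<le> n" unfolding a_def using fin n by (intro Min_le) auto
        moreover have "n < d n"
          using d[of n] n AE by (metis (no_types, lifting) A_def lessThan_iff less_imp_le
              mem_Collect_eq nat_less_le subset_iff)
        ultimately show ?thesis by simp
      qed
      then have nb: "n < b" using n by simp
      have big: "2 * s < vmax r J N f n" using n by (simp add: A_def)
      have "vmax r J N f n \<le> vmax r J b f n + s"
      proof (cases "b = N")
        case False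
        then have "b < N" using \<open>b \<le> N\<close> by simp
        have "vmax r J N f n
            \<le> lr_fin r J (\<lambda>j. fmax b (\<lambda>k. f k j) n + fmax N (\<lambda>k. f k j) b)"
          unfolding vmax_def using r f nb \<open>b < N\<close>
          by (intro lr_fin_mono fmax_split fmax_nonneg) auto
        also have "\<dots> \<le> vmax r J b f n + vmax r J N f b"
          unfolding vmax_def using r f nb \<open>b < N\<close>
          by (intro lr_fin_triangle fmax_nonneg) auto
        also have "vmax r J N f b \<le> s" using \<open>b \<notin> E\<close> \<open>b < N\<close> by (auto simp: E_def)
        finally show ?thesis by simp
      qed (use s in simp)
      then show "s < vmax r J (d n) f n" using big n by simp
    qed
    then have "card {n\<in>A. d n = b} \<le> card {n\<in>{a..<b}. s < vmax r J b f n}"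
      by (intro card_mono) auto
    then have "s * real (card {n\<in>A. d n = b}) \<le> s * real (card {n\<in>{a..<b}. s < vmax r J b f n})"
      using s by simp
    also have "\<dots> \<le> K * (\<Sum>k\<in>{a..<b}. ?F k)"
      unfolding K_def using r f s by (rule vmax_weak_type_from)
    also have "\<dots> \<le> K * (\<gamma> * s * real (b - a))"
    proof (rule mult_left_mono[OF _ K])
      have "(\<Sum>k\<in>{a..<b}. ?F k) \<le> fmax N ?F a * real (b - a)"
        using \<open>a < b\<close> \<open>b \<le> N\<close> by (rule fmax_ge)
      also have "\<dots> \<le> \<gamma> * s * real (b - a)" using Fa by (intro mult_right_mono) auto
      finally show "(\<Sum>k\<in>{a..<b}. ?F k) \<le> \<gamma> * s * real (b - a)" .
    qed
    also have "\<dots> \<le> K * (\<gamma> * s * real (card {n\<in>E. d n = b}))"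
    proof -
      have "{a..<b} \<subseteq> {n\<in>E. d n = b}"
      proof
        fix k assume "k \<in> {a..<b}"
        then show "k \<in> {n\<in>E. d n = b}" using run[of a k] ab by simp
      qed
      then have "card {a..<b} \<le> card {n\<in>E. d n = b}" using fin by (intro card_mono) auto
      then have "real (b - a) \<le> real (card {n\<in>E. d n = b})" by simp
      then show ?thesis using K \<gamma> s by (intro mult_left_mono) auto
    qed
    finally show ?thesis using s by (simp add: mult_ac)
  qed
  have fibres: "card X = (\<Sum>b\<in>d ` E. card {n\<in>X. d n = b})" if "X \<subseteq> E" for X
  proof -
    have "card X = (\<Sum>n\<in>X. 1)" by simp
    also have "\<dots> = (\<Sum>b\<in>d ` E. \<Sum>n\<in>{n\<in>X. d n = b}. 1)"
      using that fin by (intro sum.group[symmetric]) (auto intro: finite_subset)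
    finally show ?thesis by simp
  qed
  have "real (card A) = (\<Sum>b\<in>d ` E. real (card {n\<in>A. d n = b}))"
    using fibres[OF AE] by simp
  also have "\<dots> \<le> (\<Sum>b\<in>d ` E. K * \<gamma> * real (card {n\<in>E. d n = b}))"
    by (intro sum_mono piece)
  also have "\<dots> = K * \<gamma> * real (card E)"
    using fibres[of E] by (simp add: sum_distrib_left)
  finally show ?thesis by (simp add: A_def E_def K_def)
qed

definition vmax_const :: "real \<Rightarrow> real \<Rightarrow> real" where
  "vmax_const r p = 2 powr (p + 1) * (2 powr (p + 1) * (1 + hl_const r)) powr p * hl_const p"

lemma vmax_const_pos:
  assumes "1 < r" "1 < p"
  shows "0 < vmax_const r p"
proof -
  have "0 < 1 + hl_const r" "0 < hl_const p" using hl_const_pos assms by (auto simp: add_pos_pos)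
  then show ?thesis unfolding vmax_const_def by (intro mult_pos_pos) auto
qed

text \<open>Integrate the good-lambda inequality. The sum of \<open>vmax\<close> on its
  right-hand side is finite, so it can be absorbed into the left-hand side; the scalar inequality
  bounds what remains.\<close>
lemma vmax_strong_type:
  assumes r: "1 < r" and p: "1 < p" and f: "\<And>k j. 0 \<le> f k j"
  shows "(\<Sum>n<b. vmax r J b f n powr p) \<le> vmax_const r p * (\<Sum>k<b. lr_fin r J (f k) powr p)"
proof -
  let ?G = "vmax r J b f" and ?F = "\<lambda>k. lr_fin r J (f k)"
  \<comment> \<open>With \<open>\<gamma> = 1 / L\<close> the good-lambda factor is half of \<open>(1 / 2) powr p\<close>, the factor that
    passing from \<open>G\<close> to \<open>G / 2\<close> costs.\<close>
  define L where "L = 2 powr (p + 1) * (1 + hl_const r)"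
  have "0 < hl_const r" using r by (rule hl_const_pos)
  then have L: "0 < L" by (simp add: L_def)
  have \<epsilon>: "(1 + hl_const r) * (1 / L) = 1 / 2 powr (p + 1)"
    using \<open>0 < hl_const r\<close> by (simp add: L_def)
  have "(\<Sum>n<b. (?G n / 2) powr p)
      \<le> 1 / 2 powr (p + 1) * (\<Sum>n<b. ?G n powr p) + (\<Sum>n<b. (L * fmax b ?F n) powr p)"
  proof (rule sum_powr_le_of_level_sets)
    fix s :: real assume s: "0 < s"
    let ?A = "{n\<in>{..<b}. 2 * s < ?G n \<and> fmax b ?F n \<le> 1 / L * s}"
    have "{n\<in>{..<b}. s < ?G n / 2} \<subseteq> ?A \<union> {n\<in>{..<b}. s < L * fmax b ?F n}"
      using L by (auto simp: field_simps not_less)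
    then have "card {n\<in>{..<b}. s < ?G n / 2} \<le> card (?A \<union> {n\<in>{..<b}. s < L * fmax b ?F n})"
      by (intro card_mono) auto
    also have "\<dots> \<le> card ?A + card {n\<in>{..<b}. s < L * fmax b ?F n}" by (rule card_Un_le)
    finally have "real (card {n\<in>{..<b}. s < ?G n / 2})
        \<le> real (card ?A) + real (card {n\<in>{..<b}. s < L * fmax b ?F n})" by linarith
    also have "real (card ?A) \<le> 1 / 2 powr (p + 1) * real (card {n\<in>{..<b}. s < ?G n})"
      unfolding \<epsilon>[symmetric] using L by (intro vmax_good_lambda r f s) auto
    finally show "real (card {n\<in>{..<b}. s < ?G n / 2})
      \<le> 1 / 2 powr (p + 1) * real (card {n\<in>{..<b}. s < ?G n})
        + real (card {n\<in>{..<b}. s < L * fmax b ?F n})" by simp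
  qed (use p L in \<open>auto simp: vmax_nonneg intro!: fmax_nonneg mult_nonneg_nonneg\<close>)
  also have "(\<Sum>n<b. (?G n / 2) powr p) = 2 / 2 powr (p + 1) * (\<Sum>n<b. ?G n powr p)"
    by (simp add: powr_divide vmax_nonneg powr_add sum_divide_distrib)
  also have "(\<Sum>n<b. (L * fmax b ?F n) powr p) = L powr p * (\<Sum>n<b. fmax b ?F n powr p)"
    unfolding sum_distrib_left using L by (intro sum.cong refl powr_mult)
  finally have "1 / 2 powr (p + 1) * (\<Sum>n<b. ?G n powr p) \<le> L powr p * (\<Sum>n<b. fmax b ?F n powr p)"
    by (simp add: field_simps)
  also have "\<dots> \<le> L powr p * (hl_const p * (\<Sum>k<b. ?F k powr p))"
    using p by (intro mult_left_mono fmax_strong_type) auto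
  finally show ?thesis
    by (simp add: vmax_const_def L_def field_simps)
qed

section \<open>Powers of extended nonnegative reals\<close>

lemma ennpowr_ennreal:
  assumes "0 \<le> x"
  shows "ennpowr (ennreal x) a = ennreal (x powr a)"
  using assms by (simp add: ennpowr_def)

lemma ennpowr_top [simp]: "ennpowr top a = top"
  by (simp add: ennpowr_def)

lemma ennpowr_ennpowr:
  assumes "0 < a" "0 < b"
  shows "ennpowr (ennpowr x a) b = ennpowr x (a * b)"
  by (cases x) (simp_all add: ennpowr_ennreal powr_powr)

lemma ennpowr_one [simp]: "ennpowr x 1 = x"
  by (cases x) (simp_all add: ennpowr_ennreal)

lemma ennpowr_mono:
  assumes "0 < a" "x \<le> y"
  shows "ennpowr x a \<le> ennpowr y a"
proof (cases y)
  case (real y')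
  then have "x \<noteq> top" using assms by (auto simp: top_unique)
  then obtain x' where "0 \<le> x'" "x = ennreal x'" by (cases x) auto
  then show ?thesis
    using real assms by (simp add: ennpowr_ennreal powr_mono2 ennreal_leI)
qed simp

text \<open>A power with positive exponent is an order automorphism of \<open>[0,\<infinity>]\<close>: its inverse is the power with
  the reciprocal exponent.\<close>
lemma ennpowr_SUP:
  assumes "0 < a"
  shows "ennpowr (SUP i\<in>I. u i) a = (SUP i\<in>I. ennpowr (u i) a)"
proof (rule antisym)
  have inv: "ennpowr (ennpowr x a) (1 / a) = x" "ennpowr (ennpowr x (1 / a)) a = x" for x
    using assms by (simp_all add: ennpowr_ennpowr)
  have "u i \<le> ennpowr (SUP i\<in>I. ennpowr (u i) a) (1 / a)" if "i \<in> I" for i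
  proof -
    have "ennpowr (ennpowr (u i) a) (1 / a) \<le> ennpowr (SUP i\<in>I. ennpowr (u i) a) (1 / a)"
      using assms that by (intro ennpowr_mono SUP_upper) auto
    then show ?thesis by (simp add: inv)
  qed
  then have "(SUP i\<in>I. u i) \<le> ennpowr (SUP i\<in>I. ennpowr (u i) a) (1 / a)" by (rule SUP_least)
  then have "ennpowr (SUP i\<in>I. u i) a \<le> ennpowr (ennpowr (SUP i\<in>I. ennpowr (u i) a) (1 / a)) a"
    using assms by (intro ennpowr_mono) auto
  then show "ennpowr (SUP i\<in>I. u i) a \<le> (SUP i\<in>I. ennpowr (u i) a)" by (simp add: inv)
  show "(SUP i\<in>I. ennpowr (u i) a) \<le> ennpowr (SUP i\<in>I. u i) a"
    using assms by (intro SUP_least ennpowr_mono SUP_upper) auto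
qed

lemma ennpowr_cmult:
  assumes "0 < c" "0 < a"
  shows "ennpowr (ennreal c * y) a = ennreal (c powr a) * ennpowr y a"
proof (cases y)
  case (real y')
  then show ?thesis
    using assms by (simp add: ennreal_mult[symmetric] ennpowr_ennreal powr_mult)
qed (use assms in \<open>simp add: ennreal_mult_top\<close>)

lemma measurable_ennpowr [measurable]:
  assumes [measurable]: "g \<in> borel_measurable M"
  shows "(\<lambda>x. ennpowr (g x) a) \<in> borel_measurable M"
  unfolding ennpowr_def by measurable


section \<open>The ergodic maximal function as a limit of finite ones\<close>

lemma measurable_ergodic_maximal:
  assumes \<tau>: "\<tau> \<in> measurable M M" and f[measurable]: "f \<in> borel_measurable M"
  shows "ergodic_maximal \<tau> f \<in> borel_measurable M"
proof -
  note measurable_compose_n[OF \<tau>, measurable]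
  show ?thesis unfolding ergodic_maximal_def[abs_def] by measurable
qed

lemma measurable_lr_norm:
  assumes [measurable]: "\<And>j. u j \<in> borel_measurable M"
  shows "(\<lambda>x. lr_norm r (\<lambda>j. u j x)) \<in> borel_measurable M"
  unfolding lr_norm_def by measurable

text \<open>The truncation index \<open>m\<close> bounds the number of components and the window length at the same
  time, so that one monotone limit suffices.\<close>
definition window_max ::
    "real \<Rightarrow> ('a \<Rightarrow> 'a) \<Rightarrow> (nat \<Rightarrow> 'a \<Rightarrow> complex) \<Rightarrow> nat \<Rightarrow> 'a \<Rightarrow> real" where
  "window_max r \<tau> f m x = vmax r m (Suc m) (\<lambda>k j. norm (f j ((\<tau> ^^ k) x))) 0"

lemma suminf_SUP_diagonal:
  fixes c :: "nat \<Rightarrow> nat \<Rightarrow> ennreal"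
  assumes "\<And>j. incseq (\<lambda>m. c m j)"
  shows "(\<Sum>j. SUP m. c m j) = (SUP m. \<Sum>j<m. c m j)"
proof (rule antisym)
  have "(\<Sum>j<n. SUP m. c m j) \<le> (SUP m. \<Sum>j<m. c m j)" for n
  proof -
    have "(\<Sum>j<n. SUP m. c m j) = (SUP m. \<Sum>j<n. c m j)"
      using assms by (intro ennreal_SUP_sum[symmetric]) auto
    also have "\<dots> \<le> (SUP m. \<Sum>j<m. c m j)"
    proof (rule SUP_least)
      fix m
      have "(\<Sum>j<n. c m j) \<le> (\<Sum>j<max n m. c m j)" by (intro sum_mono2) auto
      also have "\<dots> \<le> (\<Sum>j<max n m. c (max n m) j)"
        using assms by (intro sum_mono) (auto intro: incseqD)
      also have "\<dots> \<le> (SUP m. \<Sum>j<m. c m j)" by (rule SUP_upper) simp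
      finally show "(\<Sum>j<n. c m j) \<le> (SUP m. \<Sum>j<m. c m j)" .
    qed
    finally show ?thesis .
  qed
  then show "(\<Sum>j. SUP m. c m j) \<le> (SUP m. \<Sum>j<m. c m j)"
    by (subst suminf_eq_SUP) (rule SUP_least)
  show "(SUP m. \<Sum>j<m. c m j) \<le> (\<Sum>j. SUP m. c m j)"
  proof (rule SUP_least)
    fix m
    have "(\<Sum>j<m. c m j) \<le> (\<Sum>j<m. SUP m. c m j)" by (intro sum_mono SUP_upper) auto
    also have "\<dots> \<le> (\<Sum>j. SUP m. c m j)" by (intro sum_le_suminf) auto
    finally show "(\<Sum>j<m. c m j) \<le> (\<Sum>j. SUP m. c m j)" .
  qed
qed

lemma fmax_mono_horizon:
  assumes "n < b" "b \<le> c"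
  shows "fmax b a n \<le> fmax c a n"
  using assms by (intro fmax_le fmax_ge) auto

lemma ergodic_maximal_eq_SUP_fmax:
  "ergodic_maximal \<tau> g x = (SUP m. ennreal (fmax (Suc m) (\<lambda>k. norm (g ((\<tau> ^^ k) x))) 0))"
proof (rule antisym)
  let ?a = "\<lambda>k. norm (g ((\<tau> ^^ k) x))"
  show "ergodic_maximal \<tau> g x \<le> (SUP m. ennreal (fmax (Suc m) ?a 0))"
    unfolding ergodic_maximal_def
  proof (rule SUP_least)
    fix n :: nat assume "n \<in> {1..}"
    then have n: "0 < n" by simp
    have "(\<Sum>k<n. ?a k) \<le> fmax (Suc n) ?a 0 * real n"
      using fmax_ge[of 0 n "Suc n" ?a] n by (simp add: lessThan_atLeast0)
    then have "1 / real n * (\<Sum>k<n. ?a k) \<le> fmax (Suc n) ?a 0"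
      using n by (simp add: divide_le_eq)
    then show "ennreal (1 / real n * (\<Sum>k<n. ?a k)) \<le> (SUP m. ennreal (fmax (Suc m) ?a 0))"
      by (intro SUP_upper2[of n] ennreal_leI) auto
  qed
  show "(SUP m. ennreal (fmax (Suc m) ?a 0)) \<le> ergodic_maximal \<tau> g x"
  proof (rule SUP_least)
    fix m
    have "fmax (Suc m) ?a 0 \<in> (\<lambda>n. (\<Sum>k\<in>{0..<n}. ?a k) / real (n - 0)) ` {0<..Suc m}"
      unfolding fmax_def by (intro Max_in) auto
    then obtain n where n: "0 < n" "fmax (Suc m) ?a 0 = (\<Sum>k\<in>{0..<n}. ?a k) / real n" by auto
    then have "fmax (Suc m) ?a 0 = 1 / real n * (\<Sum>k<n. ?a k)" by (simp add: lessThan_atLeast0)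
    then show "ennreal (fmax (Suc m) ?a 0) \<le> ergodic_maximal \<tau> g x"
      unfolding ergodic_maximal_def using n by (auto intro!: SUP_upper2[of n])
  qed
qed

lemma lr_fin_mono_length:
  assumes "0 < r" "J \<le> J'" "\<And>j. 0 \<le> u j" "\<And>j. u j \<le> v j"
  shows "lr_fin r J u \<le> lr_fin r J' v"
proof -
  have "lr_fin r J u \<le> lr_fin r J v" using assms by (intro lr_fin_mono) auto
  also have "\<dots> \<le> lr_fin r J' v"
    unfolding lr_fin_def using assms by (intro powr_mono2 sum_mono2 sum_nonneg) auto
  finally show ?thesis .
qed

lemma window_max_nonneg: "0 \<le> window_max r \<tau> f m x"
  by (simp add: window_max_def vmax_nonneg)

lemma incseq_window_max:
  assumes "0 < r"
  shows "incseq (\<lambda>m. window_max r \<tau> f m x)"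
  unfolding window_max_def vmax_def using assms
  by (intro incseq_SucI lr_fin_mono_length fmax_mono_horizon fmax_nonneg) auto

lemma lr_norm_ergodic_maximal_eq_SUP:
  assumes r: "0 < r"
  shows "lr_norm r (\<lambda>j. ergodic_maximal \<tau> (f j) x) = (SUP m. ennreal (window_max r \<tau> f m x))"
proof -
  define c where "c m j = fmax (Suc m) (\<lambda>k. norm (f j ((\<tau> ^^ k) x))) 0" for m j
  have c0: "0 \<le> c m j" for m j unfolding c_def by (intro fmax_nonneg) auto
  have inc: "incseq (\<lambda>m. ennreal (c m j powr r))" for j
    using r c0 unfolding c_def
    by (intro incseq_SucI ennreal_leI powr_mono2 fmax_mono_horizon) auto
  have "(\<Sum>j. ennpowr (ergodic_maximal \<tau> (f j) x) r) = (\<Sum>j. SUP m. ennreal (c m j powr r))"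
    using r c0 by (simp add: ergodic_maximal_eq_SUP_fmax ennpowr_SUP c_def[symmetric] ennpowr_ennreal)
  also have "\<dots> = (SUP m. \<Sum>j<m. ennreal (c m j powr r))"
    using inc by (rule suminf_SUP_diagonal)
  also have "\<dots> = (SUP m. ennreal (\<Sum>j<m. c m j powr r))" by simp
  finally show ?thesis
    using r by (simp add: lr_norm_def ennpowr_SUP ennpowr_ennreal sum_nonneg window_max_def
        vmax_def c_def lr_fin_def)
qed

lemma lr_fin_le_lr_norm:
  assumes "0 < r" "\<And>j. 0 \<le> v j"
  shows "ennreal (lr_fin r J v) \<le> lr_norm r (\<lambda>j. ennreal (v j))"
proof -
  have "ennreal (lr_fin r J v) = ennpowr (\<Sum>j<J. ennpowr (ennreal (v j)) r) (1 / r)"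
    using assms by (simp add: lr_fin_def ennpowr_ennreal sum_nonneg)
  also have "\<dots> \<le> lr_norm r (\<lambda>j. ennreal (v j))"
    unfolding lr_norm_def using assms by (intro ennpowr_mono sum_le_suminf) auto
  finally show ?thesis .
qed

lemma measurable_window_max:
  assumes \<tau>: "\<tau> \<in> measurable M M" and [measurable]: "\<And>j. f j \<in> borel_measurable M"
  shows "window_max r \<tau> f m \<in> borel_measurable M"
proof -
  note measurable_compose_n[OF \<tau>, measurable]
  have [measurable]: "(\<lambda>x. fmax (Suc m) (\<lambda>k. norm (f j ((\<tau> ^^ k) x))) 0) \<in> borel_measurable M" for j
    unfolding fmax_def by (intro borel_measurable_Max) auto
  show ?thesis unfolding window_max_def[abs_def] vmax_def lr_fin_def by measurable
qed

text \<open>Windows of length at most \<open>m + 1\<close> that start in the first \<open>m + 1\<close> points of an orbit stay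
  within the first \<open>2 * (m + 1)\<close> points.\<close>
lemma window_max_orbit:
  assumes "0 < r" "i < Suc m"
  shows "window_max r \<tau> f m ((\<tau> ^^ i) x)
    \<le> vmax r m (2 * Suc m) (\<lambda>k j. norm (f j ((\<tau> ^^ k) x))) i"
proof -
  have "fmax (Suc m) (\<lambda>k. norm (f j ((\<tau> ^^ k) ((\<tau> ^^ i) x)))) 0
      \<le> fmax (2 * Suc m) (\<lambda>k. norm (f j ((\<tau> ^^ k) x))) i" for j
  proof (rule fmax_le)
    fix n assume n: "0 < n" "n \<le> Suc m"
    have "(\<Sum>k\<in>{0..<n}. norm (f j ((\<tau> ^^ k) ((\<tau> ^^ i) x))))
        = (\<Sum>k\<in>{0 + i..<n + i}. norm (f j ((\<tau> ^^ k) x)))"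
      unfolding sum.shift_bounds_nat_ivl by (simp add: funpow_add)
    also have "\<dots> \<le> fmax (2 * Suc m) (\<lambda>k. norm (f j ((\<tau> ^^ k) x))) i * real (n - 0)"
      using fmax_ge[of i "n + i" "2 * Suc m" "\<lambda>k. norm (f j ((\<tau> ^^ k) x))"] n assms by simp
    finally show "(\<Sum>k\<in>{0..<n}. norm (f j ((\<tau> ^^ k) ((\<tau> ^^ i) x))))
        \<le> fmax (2 * Suc m) (\<lambda>k. norm (f j ((\<tau> ^^ k) x))) i * real (n - 0)" .
  qed simp
  then show ?thesis
    unfolding window_max_def vmax_def using assms
    by (intro lr_fin_mono fmax_nonneg) auto
qed

section \<open>Transference to measure-preserving systems\<close>

lemma nn_integral_measure_preserving_funpow:
  assumes \<tau>: "measure_preserving M \<tau>" and u: "u \<in> borel_measurable M"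
  shows "(\<integral>\<^sup>+x. u ((\<tau> ^^ k) x) \<partial>M) = (\<integral>\<^sup>+x. u x \<partial>M)"
proof -
  have [measurable]: "\<tau> \<in> measurable M M" using \<tau> by (simp add: measure_preserving_def)
  have distr: "distr M M \<tau> = M"
    using \<tau> by (intro measure_eqI) (auto simp: emeasure_distr measure_preserving_def)
  show ?thesis
  proof (induction k)
    case (Suc k)
    have [measurable]: "(\<lambda>x. u ((\<tau> ^^ k) x)) \<in> borel_measurable M"
      using u measurable_compose_n[of \<tau> M k] by measurable
    have "(\<integral>\<^sup>+x. u ((\<tau> ^^ Suc k) x) \<partial>M) = (\<integral>\<^sup>+x. u ((\<tau> ^^ k) (\<tau> x)) \<partial>M)"
      by (simp add: funpow_swap1)
    also have "\<dots> = (\<integral>\<^sup>+x. u ((\<tau> ^^ k) x) \<partial>distr M M \<tau>)" by (simp add: nn_integral_distr)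
    finally show ?case using Suc distr by simp
  qed simp
qed

text \<open>Integrating an inequality between orbit sums makes all summands on either side equal. On the right
  there are twice as many of them, because windows that start in the first \<open>K\<close> points may
  look as far as \<open>K\<close> points ahead. That costs a factor \<open>2\<close>, whatever \<open>K\<close> is.\<close>
lemma transference:
  assumes \<tau>: "measure_preserving M \<tau>" and K: "0 < K"
    and u: "u \<in> borel_measurable M" and v: "v \<in> borel_measurable M" and c: "0 \<le> c"
    and orbit: "\<And>x. x \<in> space M \<Longrightarrow>
      (\<Sum>i<K. u ((\<tau> ^^ i) x)) \<le> ennreal c * (\<Sum>i<2 * K. v ((\<tau> ^^ i) x))"
  shows "(\<integral>\<^sup>+x. u x \<partial>M) \<le> ennreal (2 * c) * (\<integral>\<^sup>+x. v x \<partial>M)"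
proof -
  have \<tau>': "\<tau> \<in> measurable M M" using \<tau> by (simp add: measure_preserving_def)
  have [measurable]: "(\<lambda>x. u ((\<tau> ^^ i) x)) \<in> borel_measurable M"
    "(\<lambda>x. v ((\<tau> ^^ i) x)) \<in> borel_measurable M" for i
    using u v measurable_compose_n[OF \<tau>', of i] by measurable
  have "of_nat K * (\<integral>\<^sup>+x. u x \<partial>M) = (\<Sum>i<K. \<integral>\<^sup>+x. u ((\<tau> ^^ i) x) \<partial>M)"
    using nn_integral_measure_preserving_funpow[OF \<tau> u] by simp
  also have "\<dots> = (\<integral>\<^sup>+x. (\<Sum>i<K. u ((\<tau> ^^ i) x)) \<partial>M)"
    by (rule nn_integral_sum[symmetric]) simp
  also have "\<dots> \<le> (\<integral>\<^sup>+x. ennreal c * (\<Sum>i<2 * K. v ((\<tau> ^^ i) x)) \<partial>M)"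
    by (intro nn_integral_mono orbit)
  also have "\<dots> = ennreal c * (\<Sum>i<2 * K. \<integral>\<^sup>+x. v ((\<tau> ^^ i) x) \<partial>M)"
    by (simp add: nn_integral_cmult nn_integral_sum)
  also have "\<dots> = ennreal c * (of_nat (2 * K) * (\<integral>\<^sup>+x. v x \<partial>M))"
    using nn_integral_measure_preserving_funpow[OF \<tau> v] by simp
  also have "\<dots> = of_nat K * (ennreal (2 * c) * (\<integral>\<^sup>+x. v x \<partial>M))"
    using c by (simp add: ennreal_mult mult_ac)
  finally show ?thesis
    using K by (simp add: ennreal_mult_le_mult_iff of_nat_less_top)
qed

theorem ergodic_vector_strong_type:
  assumes r: "1 < r" and p: "1 < p" and \<tau>: "measure_preserving M \<tau>"
    and f: "\<And>j. f j \<in> borel_measurable M"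
  shows "Lp_norm M p (\<lambda>x. lr_norm r (\<lambda>j. ergodic_maximal \<tau> (f j) x))
    \<le> ennreal ((2 * vmax_const r p) powr (1 / p))
      * Lp_norm M p (\<lambda>x. lr_norm r (\<lambda>j. ennreal (norm (f j x))))"
proof -
  define C where "C = vmax_const r p"
  have C: "0 < C" using vmax_const_pos[OF r p] by (simp add: C_def)
  define v where "v x = ennpowr (lr_norm r (\<lambda>j. ennreal (norm (f j x)))) p" for x
  have \<tau>': "\<tau> \<in> measurable M M" using \<tau> by (simp add: measure_preserving_def)
  have W[measurable]: "window_max r \<tau> f m \<in> borel_measurable M" for m
    using \<tau>' f by (rule measurable_window_max)
  have v: "v \<in> borel_measurable M"
    unfolding v_def[abs_def] using f by (intro measurable_ennpowr measurable_lr_norm) measurable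
  have bound: "(\<integral>\<^sup>+x. ennreal (window_max r \<tau> f m x powr p) \<partial>M) \<le> ennreal (2 * C) * (\<integral>\<^sup>+x. v x \<partial>M)" for m
  proof (rule transference[OF \<tau>, where K = "Suc m"])
    fix x assume "x \<in> space M"
    let ?h = "\<lambda>k j. norm (f j ((\<tau> ^^ k) x))"
    have "(\<Sum>i<Suc m. window_max r \<tau> f m ((\<tau> ^^ i) x) powr p)
        \<le> (\<Sum>i<Suc m. vmax r m (2 * Suc m) ?h i powr p)"
      using r p by (intro sum_mono powr_mono2 window_max_orbit) (auto simp: window_max_nonneg)
    also have "\<dots> \<le> (\<Sum>i<2 * Suc m. vmax r m (2 * Suc m) ?h i powr p)"
      by (intro sum_mono2) auto
    also have "\<dots> \<le> C * (\<Sum>i<2 * Suc m. lr_fin r m (?h i) powr p)"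
      unfolding C_def using r p by (intro vmax_strong_type) auto
    finally have "(\<Sum>i<Suc m. ennreal (window_max r \<tau> f m ((\<tau> ^^ i) x) powr p))
        \<le> ennreal C * (\<Sum>i<2 * Suc m. ennreal (lr_fin r m (?h i) powr p))"
      using C by (simp add: ennreal_mult[symmetric] sum_nonneg ennreal_leI del: sum.lessThan_Suc)
    also have "\<dots> \<le> ennreal C * (\<Sum>i<2 * Suc m. v ((\<tau> ^^ i) x))"
    proof (intro mult_left_mono sum_mono)
      fix i
      have "ennreal (lr_fin r m (?h i) powr p) = ennpowr (ennreal (lr_fin r m (?h i))) p"
        by (simp add: ennpowr_ennreal)
      also have "\<dots> \<le> v ((\<tau> ^^ i) x)"
        unfolding v_def using r p by (intro ennpowr_mono lr_fin_le_lr_norm) auto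
      finally show "ennreal (lr_fin r m (?h i) powr p) \<le> v ((\<tau> ^^ i) x)" .
    qed simp
    finally show "(\<Sum>i<Suc m. ennreal (window_max r \<tau> f m ((\<tau> ^^ i) x) powr p))
        \<le> ennreal C * (\<Sum>i<2 * Suc m. v ((\<tau> ^^ i) x))" .
  qed (use C v in auto)
  have "ennpowr (lr_norm r (\<lambda>j. ergodic_maximal \<tau> (f j) x)) p
      = (SUP m. ennreal (window_max r \<tau> f m x powr p))" for x
    using r p by (simp add: lr_norm_ergodic_maximal_eq_SUP ennpowr_SUP ennpowr_ennreal window_max_nonneg)
  then have "(\<integral>\<^sup>+x. ennpowr (lr_norm r (\<lambda>j. ergodic_maximal \<tau> (f j) x)) p \<partial>M)
      = (\<integral>\<^sup>+x. (SUP m. ennreal (window_max r \<tau> f m x powr p)) \<partial>M)" by simp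
  also have "\<dots> = (SUP m. \<integral>\<^sup>+x. ennreal (window_max r \<tau> f m x powr p) \<partial>M)"
  proof (rule nn_integral_monotone_convergence_SUP)
    show "incseq (\<lambda>m x. ennreal (window_max r \<tau> f m x powr p))"
      using r p incseq_window_max[of r \<tau> f]
      by (auto simp: incseq_def le_fun_def window_max_nonneg intro!: ennreal_leI powr_mono2)
  qed simp
  also have "\<dots> \<le> ennreal (2 * C) * (\<integral>\<^sup>+x. v x \<partial>M)" by (rule SUP_least) (rule bound)
  finally have "Lp_norm M p (\<lambda>x. lr_norm r (\<lambda>j. ergodic_maximal \<tau> (f j) x))
      \<le> ennpowr (ennreal (2 * C) * (\<integral>\<^sup>+x. v x \<partial>M)) (1 / p)"
    unfolding Lp_norm_def using p by (intro ennpowr_mono) auto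
  then show ?thesis
    using p C by (simp add: ennpowr_cmult Lp_norm_def v_def C_def)
qed

theorem ergodic_vector_weak_type:
  assumes r: "1 < r" and \<tau>: "measure_preserving M \<tau>"
    and f: "\<And>j. f j \<in> borel_measurable M" and t: "0 < t"
  shows "emeasure M {x \<in> space M. lr_norm r (\<lambda>j. ergodic_maximal \<tau> (f j) x) > ennreal t}
    \<le> ennreal (2 * (1 + hl_const r) / t)
      * Lp_norm M 1 (\<lambda>x. lr_norm r (\<lambda>j. ennreal (norm (f j x))))"
proof -
  define K where "K = 1 + hl_const r"
  have K: "0 < K" using hl_const_pos[OF r] by (simp add: K_def)
  define v where "v x = lr_norm r (\<lambda>j. ennreal (norm (f j x)))" for x
  have \<tau>': "\<tau> \<in> measurable M M" using \<tau> by (simp add: measure_preserving_def)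
  have W[measurable]: "window_max r \<tau> f m \<in> borel_measurable M" for m
    using \<tau>' f by (rule measurable_window_max)
  have v: "v \<in> borel_measurable M"
    unfolding v_def[abs_def] using f by (intro measurable_lr_norm) measurable
  define A where "A m = {x \<in> space M. t < window_max r \<tau> f m x}" for m
  have A[measurable]: "A m \<in> sets M" for m unfolding A_def by measurable
  have bound: "emeasure M (A m) \<le> ennreal (2 * (K / t)) * (\<integral>\<^sup>+x. v x \<partial>M)" for m
  proof -
    have "(\<integral>\<^sup>+x. indicator (A m) x \<partial>M) \<le> ennreal (2 * (K / t)) * (\<integral>\<^sup>+x. v x \<partial>M)"
    proof (rule transference[OF \<tau>, where K = "Suc m"])
      fix x assume x: "x \<in> space M"
      let ?h = "\<lambda>k j. norm (f j ((\<tau> ^^ k) x))"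
      let ?S = "{i\<in>{..<2 * Suc m}. t < vmax r m (2 * Suc m) ?h i}"
      have "(\<Sum>i<Suc m. indicator (A m) ((\<tau> ^^ i) x) :: ennreal)
          = of_nat (card {i\<in>{..<Suc m}. (\<tau> ^^ i) x \<in> A m})"
        by (simp add: indicator_def sum.If_cases Int_def del: sum.lessThan_Suc)
      also have "\<dots> \<le> of_nat (card ?S)"
      proof (intro of_nat_mono card_mono subsetI)
        fix i assume "i \<in> {i\<in>{..<Suc m}. (\<tau> ^^ i) x \<in> A m}"
        then have i: "i < Suc m" "t < window_max r \<tau> f m ((\<tau> ^^ i) x)" by (auto simp: A_def)
        then show "i \<in> ?S" using window_max_orbit[of r i m \<tau> f x] r by auto
      qed simp
      also have "\<dots> \<le> ennreal (K / t * (\<Sum>i<2 * Suc m. lr_fin r m (?h i)))"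
      proof -
        have "t * real (card ?S) \<le> K * (\<Sum>i<2 * Suc m. lr_fin r m (?h i))"
          unfolding K_def using r t by (intro vmax_weak_type) auto
        then have "real (card ?S) \<le> K / t * (\<Sum>i<2 * Suc m. lr_fin r m (?h i))"
          using t by (simp add: pos_le_divide_eq mult.commute)
        then show ?thesis by (simp only: ennreal_of_nat_eq_real_of_nat ennreal_leI)
      qed
      also have "\<dots> = ennreal (K / t) * (\<Sum>i<2 * Suc m. ennreal (lr_fin r m (?h i)))"
        using K t by (subst ennreal_mult) (auto simp: sum_nonneg simp del: sum.lessThan_Suc)
      also have "\<dots> \<le> ennreal (K / t) * (\<Sum>i<2 * Suc m. v ((\<tau> ^^ i) x))"
        unfolding v_def using r by (intro mult_left_mono sum_mono lr_fin_le_lr_norm) auto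
      finally show "(\<Sum>i<Suc m. indicator (A m) ((\<tau> ^^ i) x))
          \<le> ennreal (K / t) * (\<Sum>i<2 * Suc m. v ((\<tau> ^^ i) x))" .
    qed (use K t v in auto)
    then show ?thesis by simp
  qed
  have "{x \<in> space M. lr_norm r (\<lambda>j. ergodic_maximal \<tau> (f j) x) > ennreal t} = (\<Union>m. A m)"
  proof -
    have "lr_norm r (\<lambda>j. ergodic_maximal \<tau> (f j) x) > ennreal t
        \<longleftrightarrow> (\<exists>m. t < window_max r \<tau> f m x)" for x
    proof -
      have "lr_norm r (\<lambda>j. ergodic_maximal \<tau> (f j) x) = (SUP m. ennreal (window_max r \<tau> f m x))"
        using r by (intro lr_norm_ergodic_maximal_eq_SUP) auto
      then show ?thesis using t by (simp add: less_SUP_iff ennreal_less_iff)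
    qed
    then show ?thesis by (auto simp: A_def)
  qed
  moreover have "emeasure M (\<Union>m. A m) = (SUP m. emeasure M (A m))"
  proof (rule SUP_emeasure_incseq[symmetric])
    have "window_max r \<tau> f m x \<le> window_max r \<tau> f (Suc m) x" for m x
      using incseq_window_max[of r \<tau> f x] r by (auto dest: incseq_SucD)
    then have "A m \<subseteq> A (Suc m)" for m unfolding A_def by (auto intro: less_le_trans)
    then show "incseq A" by (rule incseq_SucI)
  qed auto
  moreover have "(SUP m. emeasure M (A m)) \<le> ennreal (2 * (K / t)) * (\<integral>\<^sup>+x. v x \<partial>M)"
    by (rule SUP_least) (rule bound)
  ultimately show ?thesis by (simp add: Lp_norm_def v_def K_def)
qed

section \<open>Passing to the distribution of itineraries\<close>

lemma ergodic_maximal_semiconj: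
  assumes "\<And>k. g ((\<sigma> ^^ k) (\<Phi> x)) = f ((\<tau> ^^ k) x)"
  shows "ergodic_maximal \<sigma> g (\<Phi> x) = ergodic_maximal \<tau> f x"
  unfolding ergodic_maximal_def assms by simp

abbreviation sequence_space :: "(nat \<Rightarrow> nat \<Rightarrow> complex) measure" where
  "sequence_space \<equiv> PiM UNIV (\<lambda>_. PiM UNIV (\<lambda>_. borel))"

definition itinerary :: "('a \<Rightarrow> 'a) \<Rightarrow> (nat \<Rightarrow> 'a \<Rightarrow> complex) \<Rightarrow> 'a \<Rightarrow> nat \<Rightarrow> nat \<Rightarrow> complex" where
  "itinerary \<tau> f x = (\<lambda>k j. f j ((\<tau> ^^ k) x))"

definition left_shift :: "(nat \<Rightarrow> 'b) \<Rightarrow> nat \<Rightarrow> 'b" where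
  "left_shift \<omega> = (\<lambda>k. \<omega> (Suc k))"

lemma left_shift_itinerary: "left_shift (itinerary \<tau> f x) = itinerary \<tau> f (\<tau> x)"
  by (simp add: left_shift_def itinerary_def fun_eq_iff funpow_swap1)

lemma funpow_left_shift: "(left_shift ^^ k) \<omega> n = \<omega> (n + k)"
  by (induction k arbitrary: n) (simp_all add: left_shift_def)

lemma space_sequence_space: "space sequence_space = UNIV"
  by (auto simp: space_PiM)

lemma measurable_left_shift: "left_shift \<in> measurable sequence_space sequence_space"
  unfolding left_shift_def by (rule measurable_PiM_single') (auto simp: space_PiM)

lemma measurable_itinerary:
  assumes \<tau>: "\<tau> \<in> measurable M M" and f[measurable]: "\<And>j. f j \<in> borel_measurable M"
  shows "itinerary \<tau> f \<in> measurable M sequence_space"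
proof -
  note measurable_compose_n[OF \<tau>, measurable]
  have "(\<lambda>x. f j ((\<tau> ^^ k) x)) \<in> borel_measurable M" for j k by measurable
  then show ?thesis
    unfolding itinerary_def[abs_def]
    by (intro measurable_PiM_single') (auto simp: space_PiM)
qed

lemma measurable_coordinate: "(\<lambda>\<omega>. \<omega> 0 j) \<in> borel_measurable sequence_space"
proof -
  have "(\<lambda>\<omega>. (\<lambda>u. u j) (\<omega> 0)) \<in> borel_measurable sequence_space"
    by (rule measurable_compose[where N = "PiM UNIV (\<lambda>_. borel)"])
      (auto intro: measurable_component_singleton)
  then show ?thesis by simp
qed

text \<open>The itinerary map intertwines \<open>\<tau>\<close> with the shift, so it turns an ergodic system into an ergodic system
  on the sequence space, and \<open>f j\<close> becomes the coordinate \<open>\<omega> \<mapsto> \<omega> 0 j\<close>. Both sides of the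
  two inequalities only depend on the image measure.\<close>
context
  fixes M :: "'a measure" and \<tau> :: "'a \<Rightarrow> 'a" and f :: "nat \<Rightarrow> 'a \<Rightarrow> complex"
  assumes M: "prob_space M" and erg: "ergodic_transformation M \<tau>"
    and f: "\<And>j. f j \<in> borel_measurable M"
begin

lemma erg_measurable: "\<tau> \<in> measurable M M"
  using erg by (simp add: ergodic_transformation_def measure_preserving_def)

lemma itinerary_measurable: "itinerary \<tau> f \<in> measurable M sequence_space"
  using erg_measurable f by (rule measurable_itinerary)

abbreviation "itinerary_law \<equiv> distr M sequence_space (itinerary \<tau> f)"

lemma prob_space_itinerary_law: "prob_space itinerary_law"
  using prob_space.prob_space_distr[OF M itinerary_measurable] .

lemma vimage_left_shift:
  "itinerary \<tau> f -` (left_shift -` A) \<inter> space M = \<tau> -` (itinerary \<tau> f -` A \<inter> space M) \<inter> space M"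
  using measurable_space[OF erg_measurable] by (auto simp: left_shift_itinerary)

lemma ergodic_itinerary_law: "ergodic_transformation itinerary_law left_shift"
  unfolding ergodic_transformation_def measure_preserving_def
proof (intro conjI ballI impI)
  show "left_shift \<in> measurable itinerary_law itinerary_law"
    using measurable_left_shift by simp
  fix A assume "A \<in> sets itinerary_law"
  then have A: "A \<in> sets sequence_space" by simp
  then have A': "left_shift -` A \<in> sets sequence_space"
    using measurable_sets[OF measurable_left_shift A] by (simp add: space_sequence_space)
  let ?B = "itinerary \<tau> f -` A \<inter> space M"
  have B: "?B \<in> sets M" using measurable_sets[OF itinerary_measurable A] .
  show "emeasure itinerary_law (left_shift -` A \<inter> space itinerary_law) = emeasure itinerary_law A"
  proof -
    have "emeasure itinerary_law (left_shift -` A \<inter> space itinerary_law)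
        = emeasure M (itinerary \<tau> f -` (left_shift -` A) \<inter> space M)"
      using A' by (simp add: space_sequence_space emeasure_distr[OF itinerary_measurable])
    also have "\<dots> = emeasure M (\<tau> -` ?B \<inter> space M)" by (simp only: vimage_left_shift)
    also have "\<dots> = emeasure M ?B"
      using erg B unfolding ergodic_transformation_def measure_preserving_def by blast
    also have "\<dots> = emeasure itinerary_law A" using A by (simp add: emeasure_distr[OF itinerary_measurable])
    finally show ?thesis .
  qed
  assume "left_shift -` A \<inter> space itinerary_law = A"
  then have inv: "left_shift -` A = A" by (simp add: space_sequence_space)
  have "\<tau> -` ?B \<inter> space M = ?B" by (rule vimage_left_shift[of A, unfolded inv, symmetric])
  then have "measure M ?B = 0 \<or> measure M ?B = 1"
    using erg B by (auto simp: ergodic_transformation_def)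
  then show "measure itinerary_law A = 0 \<or> measure itinerary_law A = 1"
    using A by (simp add: measure_distr[OF itinerary_measurable])
qed

lemma coordinate_measurable_itinerary_law: "(\<lambda>\<omega>. \<omega> 0 j) \<in> borel_measurable itinerary_law"
  using measurable_coordinate[of j] by simp

lemma maximal_itinerary:
  "lr_norm r (\<lambda>j. ergodic_maximal left_shift (\<lambda>\<omega>. \<omega> 0 j) (itinerary \<tau> f x))
    = lr_norm r (\<lambda>j. ergodic_maximal \<tau> (f j) x)"
proof -
  have "ergodic_maximal left_shift (\<lambda>\<omega>. \<omega> 0 j) (itinerary \<tau> f x) = ergodic_maximal \<tau> (f j) x" for j
    by (rule ergodic_maximal_semiconj) (simp add: funpow_left_shift itinerary_def)
  then show ?thesis by simp
qed

lemma measurable_maximal_sequence_space: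
  "(\<lambda>\<omega>. lr_norm r (\<lambda>j. ergodic_maximal left_shift (\<lambda>\<omega>. \<omega> 0 j) \<omega>)) \<in> borel_measurable sequence_space"
  by (intro measurable_lr_norm measurable_ergodic_maximal measurable_left_shift measurable_coordinate)

lemma measurable_lr_norm_sequence_space:
  "(\<lambda>\<omega>. lr_norm r (\<lambda>j. ennreal (norm (\<omega> 0 j :: complex)))) \<in> borel_measurable sequence_space"
proof (intro measurable_lr_norm)
  fix j
  note measurable_coordinate[of j, measurable]
  show "(\<lambda>\<omega>. ennreal (norm (\<omega> 0 j :: complex))) \<in> borel_measurable sequence_space" by measurable
qed

lemma Lp_norm_itinerary_law:
  assumes "g \<in> borel_measurable sequence_space"
  shows "Lp_norm itinerary_law p g = Lp_norm M p (\<lambda>x. g (itinerary \<tau> f x))"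
proof -
  note assms[measurable]
  show ?thesis
    unfolding Lp_norm_def by (subst nn_integral_distr[OF itinerary_measurable]) auto
qed

lemma Lp_norm_maximal_itinerary_law:
  "Lp_norm itinerary_law p (\<lambda>\<omega>. lr_norm r (\<lambda>j. ergodic_maximal left_shift (\<lambda>\<omega>. \<omega> 0 j) \<omega>))
    = Lp_norm M p (\<lambda>x. lr_norm r (\<lambda>j. ergodic_maximal \<tau> (f j) x))"
  by (simp add: Lp_norm_itinerary_law[OF measurable_maximal_sequence_space] maximal_itinerary)

lemma Lp_norm_lr_norm_itinerary_law:
  "Lp_norm itinerary_law p (\<lambda>\<omega>. lr_norm r (\<lambda>j. ennreal (norm (\<omega> 0 j))))
    = Lp_norm M p (\<lambda>x. lr_norm r (\<lambda>j. ennreal (norm (f j x))))"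
  by (simp add: Lp_norm_itinerary_law[OF measurable_lr_norm_sequence_space]) (simp add: itinerary_def)

lemma emeasure_maximal_itinerary_law:
  "emeasure itinerary_law {\<omega> \<in> space itinerary_law.
      lr_norm r (\<lambda>j. ergodic_maximal left_shift (\<lambda>\<omega>. \<omega> 0 j) \<omega>) > t}
    = emeasure M {x \<in> space M. lr_norm r (\<lambda>j. ergodic_maximal \<tau> (f j) x) > t}"
proof -
  let ?A = "{\<omega> \<in> space sequence_space. lr_norm r (\<lambda>j. ergodic_maximal left_shift (\<lambda>\<omega>. \<omega> 0 j) \<omega>) > t}"
  note measurable_maximal_sequence_space[measurable]
  have "?A \<in> sets sequence_space" by measurable
  moreover have "itinerary \<tau> f -` ?A \<inter> space M
      = {x \<in> space M. lr_norm r (\<lambda>j. ergodic_maximal \<tau> (f j) x) > t}"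
    by (auto simp: space_sequence_space maximal_itinerary)
  ultimately show ?thesis by (simp add: emeasure_distr[OF itinerary_measurable])
qed

end

text \<open>The constants are arbitrary choices among those that work on the sequence space. The
  inequalities above exhibit one each, which is what gives the choice its meaning.\<close>
lemma strong_const_spec:
  assumes "1 < r" "1 < p"
  shows "strong_const r p > 0 \<and>
    (\<forall>(M :: (nat \<Rightarrow> nat \<Rightarrow> complex) measure) \<tau> f.
        prob_space M \<longrightarrow> ergodic_transformation M \<tau> \<longrightarrow> (\<forall>j. f j \<in> borel_measurable M) \<longrightarrow>
        Lp_norm M p (\<lambda>x. lr_norm r (\<lambda>j. ergodic_maximal \<tau> (f j) x))
          \<le> ennreal (strong_const r p) * Lp_norm M p (\<lambda>x. lr_norm r (\<lambda>j. ennreal (norm (f j x)))))"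
  unfolding strong_const_def
proof (rule someI[of _ "(2 * vmax_const r p) powr (1 / p)"], intro conjI allI impI)
  show "0 < (2 * vmax_const r p) powr (1 / p)" using vmax_const_pos[OF assms] by simp
  fix M :: "(nat \<Rightarrow> nat \<Rightarrow> complex) measure" and \<tau> and f :: "nat \<Rightarrow> (nat \<Rightarrow> nat \<Rightarrow> complex) \<Rightarrow> complex"
  assume "ergodic_transformation M \<tau>" and f: "\<forall>j. f j \<in> borel_measurable M"
  then have "measure_preserving M \<tau>" by (simp add: ergodic_transformation_def)
  with assms show "Lp_norm M p (\<lambda>x. lr_norm r (\<lambda>j. ergodic_maximal \<tau> (f j) x))
      \<le> ennreal ((2 * vmax_const r p) powr (1 / p))
        * Lp_norm M p (\<lambda>x. lr_norm r (\<lambda>j. ennreal (norm (f j x))))"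
    by (rule ergodic_vector_strong_type) (use f in simp)
qed

lemma weak_const_spec:
  assumes "1 < r"
  shows "weak_const r > 0 \<and>
    (\<forall>(M :: (nat \<Rightarrow> nat \<Rightarrow> complex) measure) \<tau> f.
        prob_space M \<longrightarrow> ergodic_transformation M \<tau> \<longrightarrow> (\<forall>j. f j \<in> borel_measurable M) \<longrightarrow>
        (\<forall>t>0. emeasure M {x \<in> space M.
              lr_norm r (\<lambda>j. ergodic_maximal \<tau> (f j) x) > ennreal t}
          \<le> ennreal (weak_const r / t) * Lp_norm M 1 (\<lambda>x. lr_norm r (\<lambda>j. ennreal (norm (f j x))))))"
  unfolding weak_const_def
proof (rule someI[of _ "2 * (1 + hl_const r)"], intro conjI allI impI)
  show "0 < 2 * (1 + hl_const r)" using hl_const_pos[OF assms] by simp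
  fix M :: "(nat \<Rightarrow> nat \<Rightarrow> complex) measure" and \<tau> and f :: "nat \<Rightarrow> (nat \<Rightarrow> nat \<Rightarrow> complex) \<Rightarrow> complex"
    and t :: real
  assume "ergodic_transformation M \<tau>" and f: "\<forall>j. f j \<in> borel_measurable M" and t: "0 < t"
  then have "measure_preserving M \<tau>" by (simp add: ergodic_transformation_def)
  with assms show "emeasure M {x \<in> space M. lr_norm r (\<lambda>j. ergodic_maximal \<tau> (f j) x) > ennreal t}
      \<le> ennreal (2 * (1 + hl_const r) / t)
        * Lp_norm M 1 (\<lambda>x. lr_norm r (\<lambda>j. ennreal (norm (f j x))))"
    by (rule ergodic_vector_weak_type) (use f t in simp_all)
qed

section \<open>The Fefferman--Stein inequality for ergodic maximal functions\<close>

theorem theorem2: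
  fixes r p :: real
  assumes "1 < r" and "1 < p"
  shows "strong_const r p > 0 \<and> weak_const r > 0 \<and>
    (\<forall>(M :: 'a measure) (\<tau> :: 'a \<Rightarrow> 'a) (f :: nat \<Rightarrow> 'a \<Rightarrow> complex).
       prob_space M \<longrightarrow> ergodic_transformation M \<tau> \<longrightarrow> (\<forall>j. f j \<in> borel_measurable M) \<longrightarrow>
       Lp_norm M p (\<lambda>x. lr_norm r (\<lambda>j. ergodic_maximal \<tau> (f j) x))
         \<le> ennreal (strong_const r p)
             * Lp_norm M p (\<lambda>x. lr_norm r (\<lambda>j. ennreal (norm (f j x)))) \<and>
       (\<forall>t>0. emeasure M {x \<in> space M.
             lr_norm r (\<lambda>j. ergodic_maximal \<tau> (f j) x) > ennreal t}
         \<le> ennreal (weak_const r / t)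
             * Lp_norm M 1 (\<lambda>x. lr_norm r (\<lambda>j. ennreal (norm (f j x))))))"
proof -
  note S = strong_const_spec[OF assms] and W = weak_const_spec[OF assms(1)]
  show ?thesis
  proof (intro conjI allI impI)
    fix M :: "'a measure" and \<tau> :: "'a \<Rightarrow> 'a" and f :: "nat \<Rightarrow> 'a \<Rightarrow> complex"
    assume M: "prob_space M" and erg: "ergodic_transformation M \<tau>"
      and "\<forall>j. f j \<in> borel_measurable M"
    then have f: "f j \<in> borel_measurable M" for j by simp
    note system = prob_space_itinerary_law[OF M erg f] ergodic_itinerary_law[OF M erg f]
      coordinate_measurable_itinerary_law[OF M erg f]
    show "Lp_norm M p (\<lambda>x. lr_norm r (\<lambda>j. ergodic_maximal \<tau> (f j) x))
        \<le> ennreal (strong_const r p) * Lp_norm M p (\<lambda>x. lr_norm r (\<lambda>j. ennreal (norm (f j x))))"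
      using S[THEN conjunct2, rule_format, of _ _ "\<lambda>j \<omega>. \<omega> 0 j", OF system]
      unfolding Lp_norm_maximal_itinerary_law[OF M erg f] Lp_norm_lr_norm_itinerary_law[OF M erg f] .
    show "emeasure M {x \<in> space M. lr_norm r (\<lambda>j. ergodic_maximal \<tau> (f j) x) > ennreal t}
        \<le> ennreal (weak_const r / t) * Lp_norm M 1 (\<lambda>x. lr_norm r (\<lambda>j. ennreal (norm (f j x))))"
      if "0 < t" for t
      using W[THEN conjunct2, rule_format, of _ _ "\<lambda>j \<omega>. \<omega> 0 j", OF system that]
      unfolding emeasure_maximal_itinerary_law[OF M erg f] Lp_norm_lr_norm_itinerary_law[OF M erg f] .
  qed (use S W in auto)
qed

end
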